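(* There is an algorithm which, given as input a connected strongly chordal graph $G=(V,E)$ with at least $3$ vertices together with a strong elimination ordering $\alpha=(v_1,\dots,v_n)$ of $V$, computes a minimum-cardinality semitotal dominating set of $G$ in linear time, i.e. in time $O(|V|+|E|)$.
   Context: All graphs are finite, simple, connected and have at least $3$ vertices. For a vertex $v$, $N_G(v)$ is the set of neighbours of $v$, $N_G[v]=N_G(v)\cup\{v\}$, and $d_G(u,v)$ is the length of a shortest path between $u$ and $v$. A dominating set of $G=(V,E)$ is a set $D\subseteq V$ such that every vertex not in $D$ is adjacent to a vertex of $D$. For a graph $G$ with no isolated vertices, a semitotal dominating set (semi-TD-set) is a dominating set $D$ such that for every $u\in D$ there is a vertex $v\in D$, $v\neq u$, with $d_G(u,v)\le 2$. A minimum semi-TD-set is one of minimum cardinality among all semi-TD-sets of $G$. A vertex $v$ of a graph $G$ is simple if its closed neighbourhood can be ordered as $N_G[v]=\{u_1,u_2,\dots,u_r\}$ with $u_1=v$ such that $N_G[u_a]\subseteq N_G[u_b]$ whenever $1\le a\le b\le r$. A graph is strongly chordal if every (nonempty) induced subgraph of it has a simple vertex. Given an ordering $\alpha=(v_1,\dots,v_n)$ of $V$ and an index $i$, write $N_i[v_a]=\{v_l\in N_G[v_a] : l\ge i\}$ for $a\ge i$. The ordering $\alpha$ is a strong elimination ordering (SEO) if for all $1\le i\le j\le k\le n$, $v_j,v_k\in N_i[v_i]$ implies $N_i[v_j]\subseteq N_i[v_k]$. The graph is given by adjacency lists, and running time is measured in the usual (unit-cost RAM) model. *)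

theory Defs
  imports "Graph_Theory.Graph_Theory" "HOL-Library.Extended_Nat"
begin

section \<open>Graph notions\<close>

text \<open>
  A finite simple graph is a symmetric loop-free finite digraph without parallel arcs
  (\<^locale>\<open>graph\<close>, \<^locale>\<open>pair_graph\<close>).  Every undirected edge is
  represented there by two opposite arcs, so \<open>|E|\<close> is the cardinality of the following
  set and not that of the set of arcs.
\<close>

definition edges :: "('a,'b) pre_digraph \<Rightarrow> 'a set set" where
  "edges G = {{u, v} |u v. u \<rightarrow>\<^bsub>G\<^esub> v}"

definition nbrs :: "('a,'b) pre_digraph \<Rightarrow> 'a \<Rightarrow> 'a set" where
  "nbrs G v = {u. v \<rightarrow>\<^bsub>G\<^esub> u}"

definition closed_nbrs :: "('a,'b) pre_digraph \<Rightarrow> 'a \<Rightarrow> 'a set" where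
  "closed_nbrs G v = nbrs G v \<union> {v}"

text \<open>The distance is infinite when no path exists.\<close>

definition graph_dist :: "('a,'b) pre_digraph \<Rightarrow> 'a \<Rightarrow> 'a \<Rightarrow> enat" where
  "graph_dist G u v = (INF p \<in> {p. pre_digraph.apath G u p v}. enat (length p))"

definition dominating_set :: "('a,'b) pre_digraph \<Rightarrow> 'a set \<Rightarrow> bool" where
  "dominating_set G D \<longleftrightarrow>
     D \<subseteq> verts G \<and> (\<forall>v \<in> verts G - D. \<exists>u \<in> D. v \<rightarrow>\<^bsub>G\<^esub> u)"

definition semitotal_dominating_set :: "('a,'b) pre_digraph \<Rightarrow> 'a set \<Rightarrow> bool" where
  "semitotal_dominating_set G D \<longleftrightarrow>
     dominating_set G D \<and> (\<forall>u \<in> D. \<exists>v \<in> D. v \<noteq> u \<and> graph_dist G u v \<le> 2)"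

definition min_semitotal_dominating_set :: "('a,'b) pre_digraph \<Rightarrow> 'a set \<Rightarrow> bool" where
  "min_semitotal_dominating_set G D \<longleftrightarrow>
     semitotal_dominating_set G D \<and>
     (\<forall>D'. semitotal_dominating_set G D' \<longrightarrow> card D \<le> card D')"

definition simple_vertex :: "('a,'b) pre_digraph \<Rightarrow> 'a \<Rightarrow> bool" where
  "simple_vertex G v \<longleftrightarrow>
     (\<exists>us. distinct us \<and> set us = closed_nbrs G v \<and> us ! 0 = v \<and>
        (\<forall>a b. a \<le> b \<and> b < length us \<longrightarrow>
           closed_nbrs G (us ! a) \<subseteq> closed_nbrs G (us ! b)))"

definition strongly_chordal :: "('a,'b) pre_digraph \<Rightarrow> bool" where
  "strongly_chordal G \<longleftrightarrow>
     (\<forall>S. S \<subseteq> verts G \<and> S \<noteq> {} \<longrightarrow> (\<exists>v \<in> S. simple_vertex (G \<restriction> S) v))"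

text \<open>
  A vertex ordering is a list \<open>\<alpha>\<close>; positions are counted from 0.
  \<open>trunc_nbrs G \<alpha> i a\<close> is the set \<open>N\<^sub>i[v\<^sub>a]\<close>.
\<close>

definition trunc_nbrs :: "('a,'b) pre_digraph \<Rightarrow> 'a list \<Rightarrow> nat \<Rightarrow> nat \<Rightarrow> 'a set" where
  "trunc_nbrs G \<alpha> i a =
     {\<alpha> ! l |l. i \<le> l \<and> l < length \<alpha> \<and> \<alpha> ! l \<in> closed_nbrs G (\<alpha> ! a)}"

definition strong_elimination_ordering :: "('a,'b) pre_digraph \<Rightarrow> 'a list \<Rightarrow> bool" where
  "strong_elimination_ordering G \<alpha> \<longleftrightarrow>
     distinct \<alpha> \<and> set \<alpha> = verts G \<and>
     (\<forall>i j k. i \<le> j \<and> j \<le> k \<and> k < length \<alpha> \<and>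
        \<alpha> ! j \<in> trunc_nbrs G \<alpha> i i \<and> \<alpha> ! k \<in> trunc_nbrs G \<alpha> i i \<longrightarrow>
        trunc_nbrs G \<alpha> i j \<subseteq> trunc_nbrs G \<alpha> i k)"


section \<open>Unit-cost random access machine\<close>

text \<open>
  The RAM of Cook and Reckhow: a program is a finite list of instructions, there are infinitely
  many registers \<open>X\<^sub>0, X\<^sub>1, \<dots>\<close> holding natural numbers (so subtraction is
  truncated at 0), the input is a read-only sequence consumed from left to right, the output is a
  write-only sequence, and every instruction takes one time unit.  There is no multiplication,
  which would be too powerful at unit cost.
\<close>

datatype instr =
    Const nat nat       \<comment> \<open>\<open>Const i c\<close>: \<open>X\<^sub>i := c\<close>\<close>
  | Add nat nat nat     \<comment> \<open>\<open>Add i j k\<close>: \<open>X\<^sub>i := X\<^sub>j + X\<^sub>k\<close>\<close>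
  | Sub nat nat nat     \<comment> \<open>\<open>Sub i j k\<close>: \<open>X\<^sub>i := X\<^sub>j - X\<^sub>k\<close>\<close>
  | Load nat nat        \<comment> \<open>\<open>Load i j\<close>: \<open>X\<^sub>i := X\<^sub>m\<close> where \<open>m = X\<^sub>j\<close>\<close>
  | Store nat nat       \<comment> \<open>\<open>Store i j\<close>: \<open>X\<^sub>m := X\<^sub>j\<close> where \<open>m = X\<^sub>i\<close>\<close>
  | JumpPos nat nat     \<comment> \<open>\<open>JumpPos j l\<close>: go to instruction \<open>l\<close> if \<open>X\<^sub>j > 0\<close>\<close>
  | Read nat            \<comment> \<open>next input number; 0 when the input is exhausted\<close>
  | Print nat

record config =
  pc :: nat
  regs :: "nat \<Rightarrow> nat"
  inp :: "nat list"
  out :: "nat list"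

fun exec_instr :: "instr \<Rightarrow> config \<Rightarrow> config" where
  "exec_instr (Const i c) s = s\<lparr>pc := pc s + 1, regs := (regs s)(i := c)\<rparr>"
| "exec_instr (Add i j k) s = s\<lparr>pc := pc s + 1, regs := (regs s)(i := regs s j + regs s k)\<rparr>"
| "exec_instr (Sub i j k) s = s\<lparr>pc := pc s + 1, regs := (regs s)(i := regs s j - regs s k)\<rparr>"
| "exec_instr (Load i j) s = s\<lparr>pc := pc s + 1, regs := (regs s)(i := regs s (regs s j))\<rparr>"
| "exec_instr (Store i j) s = s\<lparr>pc := pc s + 1, regs := (regs s)(regs s i := regs s j)\<rparr>"
| "exec_instr (JumpPos j l) s = s\<lparr>pc := (if regs s j > 0 then l else pc s + 1)\<rparr>"
| "exec_instr (Read i) s =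
     s\<lparr>pc := pc s + 1,
       regs := (regs s)(i := (case inp s of [] \<Rightarrow> 0 | x # _ \<Rightarrow> x)),
       inp := tl (inp s)\<rparr>"
| "exec_instr (Print i) s = s\<lparr>pc := pc s + 1, out := out s @ [regs s i]\<rparr>"

definition halted :: "instr list \<Rightarrow> config \<Rightarrow> bool" where
  "halted P s \<longleftrightarrow> pc s \<ge> length P"

definition step :: "instr list \<Rightarrow> config \<Rightarrow> config" where
  "step P s = (if halted P s then s else exec_instr (P ! pc s) s)"

definition init :: "nat list \<Rightarrow> config" where
  "init xs = \<lparr>pc = 0, regs = (\<lambda>_. 0), inp = xs, out = []\<rparr>"

text \<open>
  Halted configurations are fixed points of \<^term>\<open>step P\<close>, so this means halting after
  at most \<open>t\<close> steps with output \<open>ys\<close>.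
\<close>

definition computes_within :: "instr list \<Rightarrow> nat list \<Rightarrow> nat \<Rightarrow> nat list \<Rightarrow> bool" where
  "computes_within P xs t ys \<longleftrightarrow>
     (let s = (step P ^^ t) (init xs) in halted P s \<and> out s = ys)"


section \<open>Input encoding\<close>

text \<open>
  The vertices of an input graph are \<open>0, \<dots>, n - 1\<close>; the neighbours of a vertex may be
  listed in any order.
\<close>

definition adjacency_lists :: "(nat,'b) pre_digraph \<Rightarrow> nat list list \<Rightarrow> bool" where
  "adjacency_lists G A \<longleftrightarrow>
     verts G = {..<length A} \<and>
     (\<forall>v < length A. distinct (A ! v) \<and> set (A ! v) = nbrs G v)"

text \<open>
  The input sequence: the number of vertices, the ordering, and then for each vertex its degree
  followed by its neighbours.
\<close>

definition encode_input :: "nat list list \<Rightarrow> nat list \<Rightarrow> nat list" where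
  "encode_input A \<alpha> = length A # \<alpha> @ concat (map (\<lambda>xs. length xs # xs) A)"

end

theory Submission
  imports Defs
begin

text \<open>
  A strong elimination ordering makes the closed neighbourhood matrix free of the configuration
  in which, for rows \<open>i \<le> j\<close> and columns \<open>k \<le> l\<close>, the entries \<open>(i, k)\<close>, \<open>(i, l)\<close>, \<open>(j, k)\<close> are
  1 and \<open>(j, l)\<close> is 0.  The algorithm scans the vertices in order.  For an undominated \<open>i\<close> it chooses
  the closed neighbour of \<open>i\<close> that dominates most of the vertices from \<open>i\<close> on, where ties are broken in
  favour of one with a neighbour before \<open>i\<close>.  If a chosen vertex \<open>u\<close> still has no other chosen vertex
  at distance at most 2 when its last closed neighbour \<open>p\<close> is scanned, then the last closed neighbour
  of \<open>p\<close> is chosen as well (or any neighbour of \<open>u\<close>, if that is \<open>u\<close> itself).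

  Optimality is certified by a packing: every semitotal dominating set meets the closed
  neighbourhood of each scanned undominated vertex, and it has at least two vertices in the ball of
  radius 2 around each \<open>u\<close> that received a partner.  With one such set for each vertex that was undominated when it
  was scanned, these sets are pairwise disjoint, and the numbers add up to the size of the
  constructed set.
\<close>

section \<open>A structured language on top of the machine\<close>

text \<open>The delicate part of the lower bound is the count of two in a ball around
  \<open>u\<close>: a competing set might place one vertex \<open>x\<close> near the scanned
  \<open>v\<close> and keep its companion outside the ball. This is excluded when the closed
  neighbourhood of \<open>u\<close> is inclusion-maximal among those of the closed neighbours of
  \<open>v\<close>. The greedy choice gives this only for the vertices from \<open>v\<close> on; the
  tie-break extends it to all vertices exactly when \<open>u\<close> does not obtain a companion for
  free. The partner is taken late and as far out as possible so that, together with
  \<open>u\<close>, it dominates every later vertex whose closed neighbourhood meets the ball. This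
  keeps the packing disjoint. For linear time, two searches must be avoided. The sizes of the
  remaining neighbourhoods are kept up to date by local decrements, and proximity within distance 2
  is decided without exploring balls: one recorded dominator per vertex is enough.\<close>

datatype com =
    Lit nat nat
  | Plus nat nat nat
  | Minus nat nat nat
  | Get nat nat nat
  | Put nat nat nat
  | Inp nat
  | Outp nat
  | Seq com com  (infixr ";;" 60)
  | Cond nat com com
  | Loop nat com

text \<open>
  A state has scalars \<open>sc\<close> and infinite arrays \<open>ar\<close>; \<open>Get i k j\<close> assigns the entry of
  array \<open>k\<close> at index \<open>X\<^sub>j\<close> to \<open>X\<^sub>i\<close>, and \<open>Put k j i\<close> does the converse.  The clock
  \<open>tm\<close> is an upper bound for the time that the compiled code takes.
\<close>

record state =
  sc :: "nat \<Rightarrow> nat"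
  ar :: "nat \<Rightarrow> nat \<Rightarrow> nat"
  rin :: "nat list"
  rout :: "nat list"
  tm :: nat

abbreviation tick :: "nat \<Rightarrow> state \<Rightarrow> state" where
  "tick k s \<equiv> s\<lparr>tm := tm s + k\<rparr>"

inductive big :: "com \<Rightarrow> state \<Rightarrow> state \<Rightarrow> bool" where
  Lit: "big (Lit i c) s (s\<lparr>sc := (sc s)(i := c), tm := tm s + 1\<rparr>)"
| Plus: "big (Plus i j k) s (s\<lparr>sc := (sc s)(i := sc s j + sc s k), tm := tm s + 1\<rparr>)"
| Minus: "big (Minus i j k) s (s\<lparr>sc := (sc s)(i := sc s j - sc s k), tm := tm s + 1\<rparr>)"
| Get: "big (Get i k j) s (s\<lparr>sc := (sc s)(i := ar s k (sc s j)), tm := tm s + 7\<rparr>)"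
| Put: "big (Put k j i) s
    (s\<lparr>ar := (ar s)(k := (ar s k)(sc s j := sc s i)), tm := tm s + 7\<rparr>)"
| Inp: "big (Inp i) s
    (s\<lparr>sc := (sc s)(i := (case rin s of [] \<Rightarrow> 0 | x # _ \<Rightarrow> x)), rin := tl (rin s), tm := tm s + 1\<rparr>)"
| Outp: "big (Outp i) s (s\<lparr>rout := rout s @ [sc s i], tm := tm s + 1\<rparr>)"
| Seq: "big c s s' \<Longrightarrow> big d s' s'' \<Longrightarrow> big (c ;; d) s s''"
| CondT: "sc s r > 0 \<Longrightarrow> big c (tick 3 s) s' \<Longrightarrow> big (Cond r c d) s s'"
| CondF: "sc s r = 0 \<Longrightarrow> big d (tick 3 s) s' \<Longrightarrow> big (Cond r c d) s s'"
| LoopT: "sc s r > 0 \<Longrightarrow> big c (tick 3 s) s' \<Longrightarrow> big (Loop r c) s' s'' \<Longrightarrow> big (Loop r c) s s''"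
| LoopF: "sc s r = 0 \<Longrightarrow> big (Loop r c) s (tick 3 s)"

text \<open>
  Registers 0 and 1 are scratch registers for addresses, scalar \<open>i\<close> (for \<open>2 \<le> i < 32\<close>) is
  register \<open>i\<close>, and entry \<open>j\<close> of array \<open>k < 16\<close> is register \<open>32 + 16 j + k\<close>.
\<close>

definition address :: "nat \<Rightarrow> nat \<Rightarrow> instr list" where
  "address k j =
     [Add 0 j j, Add 0 0 0, Add 0 0 0, Add 0 0 0, Const 1 (32 + k), Add 0 0 1]"

text \<open>The machine has only conditional jumps, so an unconditional one first makes a scratch
  register positive.\<close>

definition goto :: "nat \<Rightarrow> instr list" where
  "goto l = [Const 0 1, JumpPos 0 l]"

fun clen :: "com \<Rightarrow> nat" where
  "clen (Lit _ _) = 1"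
| "clen (Plus _ _ _) = 1"
| "clen (Minus _ _ _) = 1"
| "clen (Get _ _ _) = 7"
| "clen (Put _ _ _) = 7"
| "clen (Inp _) = 1"
| "clen (Outp _) = 1"
| "clen (c ;; d) = clen c + clen d"
| "clen (Cond r c d) = clen c + clen d + 3"
| "clen (Loop r c) = clen c + 5"

text \<open>Jump targets are absolute, hence the argument \<open>a\<close>, the address at which the
  code will start. In a conditional the code of the second branch comes first, because falling
  through the jump means that the test was zero.\<close>

fun compile :: "nat \<Rightarrow> com \<Rightarrow> instr list" where
  "compile a (Lit i c) = [Const i c]"
| "compile a (Plus i j k) = [Add i j k]"
| "compile a (Minus i j k) = [Sub i j k]"
| "compile a (Get i k j) = address k j @ [Load i 0]"
| "compile a (Put k j i) = address k j @ [Store 0 i]"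
| "compile a (Inp i) = [Read i]"
| "compile a (Outp i) = [Print i]"
| "compile a (c ;; d) = compile a c @ compile (a + clen c) d"
| "compile a (Cond r c d) =
     JumpPos r (a + clen d + 3) # compile (a + 1) d @ goto (a + clen d + 3 + clen c)
       @ compile (a + clen d + 3) c"
| "compile a (Loop r c) =
     JumpPos r (a + 3) # goto (a + clen c + 5) @ compile (a + 3) c @ goto a"

fun wf_com :: "com \<Rightarrow> bool" where
  "wf_com (Lit i _) \<longleftrightarrow> i \<in> {2..<32}"
| "wf_com (Plus i j k) \<longleftrightarrow> {i, j, k} \<subseteq> {2..<32}"
| "wf_com (Minus i j k) \<longleftrightarrow> {i, j, k} \<subseteq> {2..<32}"
| "wf_com (Get i k j) \<longleftrightarrow> {i, j} \<subseteq> {2..<32} \<and> k < 16"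
| "wf_com (Put k j i) \<longleftrightarrow> {i, j} \<subseteq> {2..<32} \<and> k < 16"
| "wf_com (Inp i) \<longleftrightarrow> i \<in> {2..<32}"
| "wf_com (Outp i) \<longleftrightarrow> i \<in> {2..<32}"
| "wf_com (c ;; d) \<longleftrightarrow> wf_com c \<and> wf_com d"
| "wf_com (Cond r c d) \<longleftrightarrow> r \<in> {2..<32} \<and> wf_com c \<and> wf_com d"
| "wf_com (Loop r c) \<longleftrightarrow> r \<in> {2..<32} \<and> wf_com c"

section \<open>Correctness of the compiler and of its clock\<close>

lemma length_compile [simp]: "length (compile a c) = clen c"
  by (induction c arbitrary: a) (auto simp: address_def goto_def)

lemma length_goto [simp]: "length (goto l) = 2"
  by (simp add: goto_def)

fun code_at :: "instr list \<Rightarrow> nat \<Rightarrow> instr list \<Rightarrow> bool" where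
  "code_at P a [] \<longleftrightarrow> True"
| "code_at P a (x # xs) \<longleftrightarrow> a < length P \<and> P ! a = x \<and> code_at P (Suc a) xs"

lemma code_at_append [simp]:
  "code_at P a (xs @ ys) \<longleftrightarrow> code_at P a xs \<and> code_at P (a + length xs) ys"
  by (induction xs arbitrary: a) auto

lemma code_at_suffix: "code_at (xs @ ys) (length xs) ys"
proof (induction ys arbitrary: xs)
  case (Cons y ys)
  from Cons.IH[of "xs @ [y]"] show ?case by simp
qed simp

definition sim :: "state \<Rightarrow> config \<Rightarrow> bool" where
  "sim s g \<longleftrightarrow> (\<forall>i\<in>{2..<32}. regs g i = sc s i) \<and> (\<forall>k<16. \<forall>j. regs g (32 + 16 * j + k) = ar s k j)
     \<and> inp g = rin s \<and> out g = rout s"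

text \<open>The step count is only bounded by \<open>t\<close>: the clock may overcharge, as it does
  for the first branch of a conditional.\<close>

definition reaches :: "instr list \<Rightarrow> nat \<Rightarrow> config \<Rightarrow> state \<Rightarrow> nat \<Rightarrow> bool" where
  "reaches P t g s a \<longleftrightarrow>
     (\<exists>u \<le> t. sim s ((step P ^^ u) g) \<and> pc ((step P ^^ u) g) = a)"

lemma reaches_step:
  assumes "pc g < length P" "P ! pc g = i" "reaches P t (exec_instr i g) s a"
  shows "reaches P (Suc t) g s a"
proof -
  obtain u where "u \<le> t" "sim s ((step P ^^ u) (exec_instr i g))"
      "pc ((step P ^^ u) (exec_instr i g)) = a"
    using assms(3) by (auto simp: reaches_def)
  moreover have "(step P ^^ Suc u) g = (step P ^^ u) (exec_instr i g)"
    using assms(1,2) by (simp add: funpow_swap1 step_def halted_def)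
  ultimately show ?thesis unfolding reaches_def by (intro exI[of _ "Suc u"]) auto
qed

lemma reaches_refl: "sim s g \<Longrightarrow> pc g = a \<Longrightarrow> reaches P t g s a"
  by (auto simp: reaches_def intro!: exI[of _ 0])

lemma reaches_trans:
  assumes "reaches P t g s a"
    and "\<And>h. sim s h \<Longrightarrow> pc h = a \<Longrightarrow> reaches P t' h s' a'"
  shows "reaches P (t + t') g s' a'"
proof -
  obtain u where u: "u \<le> t" "sim s ((step P ^^ u) g)" "pc ((step P ^^ u) g) = a"
    using assms(1) by (auto simp: reaches_def)
  obtain v where v: "v \<le> t'" "sim s' ((step P ^^ v) ((step P ^^ u) g))"
      "pc ((step P ^^ v) ((step P ^^ u) g)) = a'"
    using assms(2)[OF u(2,3)] by (auto simp: reaches_def)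
  have "(step P ^^ (v + u)) g = (step P ^^ v) ((step P ^^ u) g)"
    by (simp add: funpow_add)
  with u v show ?thesis unfolding reaches_def by (intro exI[of _ "v + u"]) auto
qed

lemma reaches_mono: "reaches P t g s a \<Longrightarrow> t \<le> t' \<Longrightarrow> reaches P t' g s a"
  by (auto simp: reaches_def intro: order_trans)

lemma sim_tick [simp]: "sim (s\<lparr>tm := t\<rparr>) g \<longleftrightarrow> sim s g"
  by (simp add: sim_def)

lemma sim_pc [simp]: "sim s (g\<lparr>pc := a\<rparr>) \<longleftrightarrow> sim s g"
  by (simp add: sim_def)

lemma sim_scratch [simp]: "sim s (g\<lparr>regs := (regs g)(0 := x)\<rparr>) \<longleftrightarrow> sim s g"
  by (simp add: sim_def)

lemma reaches_single:
  assumes "pc g < length P" "P ! pc g = i" "sim s (exec_instr i g)" "pc (exec_instr i g) = a" "0 < t"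
  shows "reaches P t g s a"
  using reaches_step[OF assms(1,2) reaches_refl[OF assms(3,4)]] assms(5) by (cases t) auto

lemma reaches_goto:
  assumes "code_at P (pc g) (goto l)" "sim s g"
  shows "reaches P 2 g s l"
  unfolding numeral_2_eq_2
  by (rule reaches_step[where i = "Const 0 1", OF _ _ reaches_single[where i = "JumpPos 0 l"]])
    (use assms in \<open>auto simp: goto_def\<close>)

lemma cell_inj:
  assumes "k < 16" "k' < 16"
  shows "32 + 16 * j + k = 32 + 16 * j' + k' \<longleftrightarrow> k = k' \<and> j = (j'::nat)"
proof
  assume *: "32 + 16 * j + k = 32 + 16 * j' + k'"
  then have "16 * j + k = 16 * j' + k'" by linarith
  then have "(16 * j + k) mod 16 = (16 * j' + k') mod 16" by (rule arg_cong)
  then have "k = k'" using assms by simp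
  with * show "k = k' \<and> j = j'" by simp
qed simp

lemma reaches_address:
  assumes "code_at P (pc g) (address k j)" "j \<ge> 2"
    and "reaches P t (g\<lparr>pc := pc g + 6,
        regs := (regs g)(0 := 32 + 16 * regs g j + k, 1 := 32 + k)\<rparr>) s a"
  shows "reaches P (t + 6) g s a"
proof -
  let ?x = "regs g j"
  \<comment> \<open>\<open>h n x\<close> is the configuration after \<open>n\<close> of the six
    instructions. The claims go backwards from the last instruction; going forwards, scratch
    register 0 holds 2, 4, 8 and 16 times the index, which replaces a multiplication.\<close>
  define h where "h n x = g\<lparr>pc := pc g + n, regs := (regs g)(0 := x)\<rparr>" for n x
  have code: "pc g + 5 < length P" "P ! pc g = Add 0 j j" "P ! (pc g + 1) = Add 0 0 0"
    "P ! (pc g + 2) = Add 0 0 0" "P ! (pc g + 3) = Add 0 0 0" "P ! (pc g + 4) = Const 1 (32 + k)"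
    "P ! (pc g + 5) = Add 0 0 1"
    using assms(1) by (auto simp: address_def eval_nat_numeral)
  have last: "exec_instr (Add 0 0 1) (exec_instr (Const 1 (32 + k)) (h 4 (16 * ?x)))
      = g\<lparr>pc := pc g + 6, regs := (regs g)(0 := 32 + 16 * regs g j + k, 1 := 32 + k)\<rparr>"
    by (auto simp: h_def fun_eq_iff)
  have "reaches P (Suc (Suc t)) (h 4 (16 * ?x)) s a"
    by (rule reaches_step[where i = "Const 1 (32 + k)", OF _ _ reaches_step[where i = "Add 0 0 1"]])
      (use code assms(3) in \<open>simp_all only: last, simp_all add: h_def add.commute[of 5]\<close>)
  note r = this
  have "reaches P (Suc (Suc (Suc t))) (h 3 (8 * ?x)) s a"
    by (rule reaches_step[where i = "Add 0 0 0"]) (use code r in \<open>auto simp: h_def add.commute[of _ "pc g"] simp del: add_2_eq_Suc add_2_eq_Suc'\<close>)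
  note r = this
  have "reaches P (Suc (Suc (Suc (Suc t)))) (h 2 (4 * ?x)) s a"
    by (rule reaches_step[where i = "Add 0 0 0"]) (use code r in \<open>auto simp: h_def add.commute[of _ "pc g"] simp del: add_2_eq_Suc add_2_eq_Suc'\<close>)
  note r = this
  have "reaches P (Suc (Suc (Suc (Suc (Suc t))))) (h 1 (2 * ?x)) s a"
    by (rule reaches_step[where i = "Add 0 0 0"]) (use code r in \<open>auto simp: h_def\<close>)
  note r = this
  have "reaches P (Suc (Suc (Suc (Suc (Suc (Suc t)))))) g s a"
    by (rule reaches_step[where i = "Add 0 j j"]) (use code r in \<open>auto simp: h_def mult_2\<close>)
  then show ?thesis by (simp add: eval_nat_numeral)
qed

text \<open>Monotonicity of the clock is proved along with the simulation, since the budgets are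
  truncated differences of clock values and add up only if these values increase.\<close>

lemma compile_correct:
  assumes "big c s s'" "wf_com c" "code_at P (pc g) (compile (pc g) c)" "sim s g"
  shows "tm s \<le> tm s' \<and> reaches P (tm s' - tm s) g s' (pc g + clen c)"
  using assms
proof (induction arbitrary: g rule: big.induct)
  case (Get i k j s)
  have last: "pc g + 6 < length P" "P ! (pc g + 6) = Load i 0"
    using Get.prems(2) by (auto simp: address_def eval_nat_numeral)
  have "reaches P (1 + 6) g (s\<lparr>sc := (sc s)(i := ar s k (sc s j)), tm := tm s + 7\<rparr>) (pc g + 7)"
  proof (rule reaches_address)
    show "code_at P (pc g) (address k j)" "2 \<le> j" using Get by auto
    show "reaches P 1 (g\<lparr>pc := pc g + 6, regs := (regs g)(0 := 32 + 16 * regs g j + k, 1 := 32 + k)\<rparr>)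
       (s\<lparr>sc := (sc s)(i := ar s k (sc s j)), tm := tm s + 7\<rparr>) (pc g + 7)"
      by (rule reaches_single[where i = "Load i 0"]) (use Get last in \<open>auto simp: sim_def address_def\<close>)
  qed
  then show ?case by simp
next
  case (Put k j i s)
  have last: "pc g + 6 < length P" "P ! (pc g + 6) = Store 0 i"
    using Put.prems(2) by (auto simp: address_def eval_nat_numeral)
  have "reaches P (1 + 6) g (s\<lparr>ar := (ar s)(k := (ar s k)(sc s j := sc s i)), tm := tm s + 7\<rparr>) (pc g + 7)"
  proof (rule reaches_address)
    show "code_at P (pc g) (address k j)" "2 \<le> j" using Put by auto
    have cell: "32 + 16 * l + m = 32 + 16 * sc s j + k \<longleftrightarrow> m = k \<and> l = sc s j" if "m < 16" for l m
      using Put that by (intro cell_inj) auto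
    show "reaches P 1 (g\<lparr>pc := pc g + 6, regs := (regs g)(0 := 32 + 16 * regs g j + k, 1 := 32 + k)\<rparr>)
       (s\<lparr>ar := (ar s)(k := (ar s k)(sc s j := sc s i)), tm := tm s + 7\<rparr>) (pc g + 7)"
      by (rule reaches_single[where i = "Store 0 i"]) (use Put last cell in \<open>auto simp: sim_def address_def simp del: add_left_cancel\<close>)
  qed
  then show ?case by simp
next
  case (Seq c s s' d s'')
  have 1: "tm s \<le> tm s'" "reaches P (tm s' - tm s) g s' (pc g + clen c)"
    using Seq.IH(1)[of g] Seq.prems by auto
  have 2: "tm s' \<le> tm s'' \<and> reaches P (tm s'' - tm s') h s'' (pc g + clen c + clen d)"
    if "sim s' h" "pc h = pc g + clen c" for h
    using Seq.IH(2)[of h] Seq.prems that by auto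
  obtain h where "sim s' h" "pc h = pc g + clen c"
    using 1(2) by (auto simp: reaches_def)
  then have "tm s' \<le> tm s''" using 2 by blast
  moreover have "reaches P ((tm s' - tm s) + (tm s'' - tm s')) g s'' (pc g + clen c + clen d)"
    using 1 2 by (blast intro: reaches_trans)
  ultimately show ?case using 1 by (simp add: add.assoc)
next
  case (CondT s r c s' d)
  define h where "h = g\<lparr>pc := pc g + clen d + 3\<rparr>"
  have 1: "tm s + 3 \<le> tm s'" "reaches P (tm s' - (tm s + 3)) h s' (pc h + clen c)"
    using CondT.IH[of h] CondT.prems by (auto simp: h_def eval_nat_numeral)
  have "reaches P (Suc (tm s' - (tm s + 3))) g s' (pc h + clen c)"
    by (rule reaches_step[where i = "JumpPos r (pc g + clen d + 3)"])
      (use CondT 1(2) in \<open>auto simp: h_def sim_def\<close>)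
  with 1 show ?case by (auto elim!: reaches_mono simp: h_def add_ac)
next
  case (CondF s r d s' c)
  define h where "h = g\<lparr>pc := pc g + 1\<rparr>"
  have 1: "tm s + 3 \<le> tm s'" "reaches P (tm s' - (tm s + 3)) h s' (pc h + clen d)"
    using CondF.IH[of h] CondF.prems by (auto simp: h_def)
  have "reaches P (Suc (tm s' - (tm s + 3))) g s' (pc h + clen d)"
    by (rule reaches_step[where i = "JumpPos r (pc g + clen d + 3)"])
      (use CondF 1(2) in \<open>auto simp: h_def sim_def\<close>)
  then have "reaches P (Suc (tm s' - (tm s + 3)) + 2) g s' (pc g + clen d + 3 + clen c)"
    by (rule reaches_trans) (use CondF.prems in \<open>auto intro!: reaches_goto simp: h_def\<close>)
  with 1 show ?case by (auto elim!: reaches_mono simp: h_def add_ac)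
next
  case (LoopT s r c s' s'')
  define h where "h = g\<lparr>pc := pc g + 3\<rparr>"
  have 1: "tm s + 3 \<le> tm s'" "reaches P (tm s' - (tm s + 3)) h s' (pc h + clen c)"
    using LoopT.IH(1)[of h] LoopT.prems by (auto simp: h_def eval_nat_numeral)
  have "reaches P (Suc (tm s' - (tm s + 3))) g s' (pc h + clen c)"
    by (rule reaches_step[where i = "JumpPos r (pc g + 3)"])
      (use LoopT 1(2) in \<open>auto simp: h_def sim_def\<close>)
  then have "reaches P (Suc (tm s' - (tm s + 3)) + 2) g s' (pc g)"
    by (rule reaches_trans)
      (use LoopT.prems in \<open>auto intro!: reaches_goto simp: h_def numeral_3_eq_3\<close>)
  with 1 have 2: "reaches P (tm s' - tm s) g s' (pc g)"
    by (auto elim!: reaches_mono)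
  have 3: "tm s' \<le> tm s'' \<and> reaches P (tm s'' - tm s') k s'' (pc g + clen (Loop r c))"
    if "sim s' k" "pc k = pc g" for k
    using LoopT.IH(2)[of k] LoopT.prems that by auto
  obtain k where "sim s' k" "pc k = pc g"
    using 2 by (auto simp: reaches_def)
  then have "tm s' \<le> tm s''" using 3 by blast
  moreover have "reaches P ((tm s' - tm s) + (tm s'' - tm s')) g s'' (pc g + clen (Loop r c))"
    using 2 3 by (blast intro: reaches_trans)
  ultimately show ?case using 1 by simp
next
  case (LoopF s r c)
  have "reaches P (Suc 2) g (tick 3 s) (pc g + clen (Loop r c))"
    by (rule reaches_step[where i = "JumpPos r (pc g + 3)"])
      (use LoopF in \<open>auto intro!: reaches_goto simp: sim_def add_ac\<close>)
  then show ?case by simp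
qed (auto intro!: reaches_single simp: sim_def)

definition start_state :: "nat list \<Rightarrow> state" where
  "start_state xs = \<lparr>sc = \<lambda>_. 0, ar = \<lambda>_ _. 0, rin = xs, rout = [], tm = 0\<rparr>"

lemma step_funpow_halted: "halted P g \<Longrightarrow> (step P ^^ t) g = g"
  by (induction t) (auto simp: step_def)

lemma computes_within_compile:
  assumes "big c (start_state xs) s" "wf_com c" "tm s \<le> t"
  shows "computes_within (compile 0 c) xs t (rout s)"
proof -
  let ?P = "compile 0 c"
  have "reaches ?P (tm s) (init xs) s (clen c)"
    using compile_correct[OF assms(1,2), of ?P "init xs"] code_at_suffix[of "[]" ?P]
    by (auto simp: sim_def init_def start_state_def)
  then obtain u where u: "u \<le> tm s" "sim s ((step ?P ^^ u) (init xs))"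
      "pc ((step ?P ^^ u) (init xs)) = clen c"
    by (auto simp: reaches_def)
  have "(step ?P ^^ t) (init xs) = (step ?P ^^ (t - u)) ((step ?P ^^ u) (init xs))"
    using u(1) assms(3) by (simp flip: funpow_add o_apply[where f = "step ?P ^^ (t - u)"])
  also have "\<dots> = (step ?P ^^ u) (init xs)"
    by (rule step_funpow_halted) (simp add: halted_def u)
  finally show ?thesis using u by (simp add: computes_within_def halted_def sim_def)
qed

subsection \<open>Weakest preconditions\<close>

text \<open>A terminating run is demanded, so this is total correctness; time bounds are ordinary
  assertions about \<open>tm\<close>.\<close>

definition wp :: "com \<Rightarrow> (state \<Rightarrow> bool) \<Rightarrow> state \<Rightarrow> bool" where
  "wp c Q s \<longleftrightarrow> (\<exists>s'. big c s s' \<and> Q s')"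

inductive_cases big_elims:
  "big (Lit i c) s s'" "big (Plus i j k) s s'" "big (Minus i j k) s s'" "big (Get i k j) s s'"
  "big (Put k j i) s s'" "big (Inp i) s s'" "big (Outp i) s s'" "big (c ;; d) s s'"
  "big (Cond r c d) s s'"

lemma wp_simps [simp]:
  "wp (Lit i c) Q s = Q (s\<lparr>sc := (sc s)(i := c), tm := tm s + 1\<rparr>)"
  "wp (Plus i j k) Q s = Q (s\<lparr>sc := (sc s)(i := sc s j + sc s k), tm := tm s + 1\<rparr>)"
  "wp (Minus i j k) Q s = Q (s\<lparr>sc := (sc s)(i := sc s j - sc s k), tm := tm s + 1\<rparr>)"
  "wp (Get i l j) Q s = Q (s\<lparr>sc := (sc s)(i := ar s l (sc s j)), tm := tm s + 7\<rparr>)"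
  "wp (Put l j i) Q s = Q (s\<lparr>ar := (ar s)(l := (ar s l)(sc s j := sc s i)), tm := tm s + 7\<rparr>)"
  "wp (Inp i) Q s = Q (s\<lparr>sc := (sc s)(i := (case rin s of [] \<Rightarrow> 0 | x # _ \<Rightarrow> x)),
     rin := tl (rin s), tm := tm s + 1\<rparr>)"
  "wp (Outp i) Q s = Q (s\<lparr>rout := rout s @ [sc s i], tm := tm s + 1\<rparr>)"
  "wp (Seq c1 c2) Q s = wp c1 (wp c2 Q) s"
  by (auto simp: wp_def intro: big.intros elim!: big_elims)

lemma wp_Seq: "wp (c ;; d) Q = wp c (wp d Q)"
  by (rule ext) simp

lemma wp_Cond [simp]:
  "wp (Cond r c d) Q s = (if sc s r > 0 then wp c Q (tick 3 s) else wp d Q (tick 3 s))"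
  by (auto simp: wp_def intro: big.intros elim!: big_elims)

lemma wp_mono: "wp c Q s \<Longrightarrow> (\<And>s'. Q s' \<Longrightarrow> Q' s') \<Longrightarrow> wp c Q' s"
  by (auto simp: wp_def)

lemma wp_Loop:
  fixes a b :: nat
  assumes "I a s" "a \<le> b"
    and "\<And>j s. I j s \<Longrightarrow> a \<le> j \<Longrightarrow> j < b \<Longrightarrow> sc s r > 0 \<and> wp c (I (Suc j)) (tick 3 s)"
    and "\<And>s. I b s \<Longrightarrow> sc s r = 0 \<and> Q (tick 3 s)"
  shows "wp (Loop r c) Q s"
proof -
  have "wp (Loop r c) Q s" if "I j s" "a \<le> j" "j \<le> b" for j
    using that
  proof (induction "b - j" arbitrary: j s)
    case 0
    then show ?case using assms(4)[of s] by (auto simp: wp_def intro: big.LoopF)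
  next
    case (Suc k)
    then have "j < b" by simp
    then obtain s' where "big c (tick 3 s) s'" "I (Suc j) s'" "sc s r > 0"
      using assms(3)[of j s] Suc by (auto simp: wp_def)
    moreover have "wp (Loop r c) Q s'"
      by (rule Suc.hyps(1)[of "Suc j"]) (use Suc \<open>j < b\<close> calculation in auto)
    ultimately show ?case by (auto simp: wp_def intro: big.LoopT)
  qed
  then show ?thesis using assms by blast
qed

section \<open>The greedy algorithm on a symmetric matrix without the forbidden configuration\<close>

locale gamma_free =
  fixes n :: nat and R :: "nat \<Rightarrow> nat \<Rightarrow> bool"
  assumes R_less: "R i j \<Longrightarrow> i < n"
    and R_sym: "R i j \<Longrightarrow> R j i"
    and R_refl: "i < n \<Longrightarrow> R i i"
    and gamma: "i \<le> j \<Longrightarrow> k \<le> l \<Longrightarrow> R i k \<Longrightarrow> R i l \<Longrightarrow> R j k \<Longrightarrow> R j l"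
begin

definition top :: "nat \<Rightarrow> nat" where
  "top u = Max {j. R u j}"

definition dominated :: "nat set \<Rightarrow> nat \<Rightarrow> bool" where
  "dominated D v \<longleftrightarrow> (\<exists>d\<in>D. R v d)"

text \<open>Since \<open>R\<close> is reflexive, \<open>y\<close> may be \<open>u\<close> or
  \<open>d\<close>, so distance 1 is covered together with distance 2.\<close>

definition near :: "nat set \<Rightarrow> nat \<Rightarrow> bool" where
  "near D u \<longleftrightarrow> (\<exists>d\<in>D. d \<noteq> u \<and> (\<exists>y. R u y \<and> R y d))"

definition semitotal :: "nat set \<Rightarrow> bool" where
  "semitotal D \<longleftrightarrow> D \<subseteq> {..<n} \<and> (\<forall>v<n. dominated D v) \<and> (\<forall>u\<in>D. near D u)"

lemma R_less2: "R i j \<Longrightarrow> j < n"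
  using R_less R_sym by blast

lemma finite_R [simp]: "finite {j. R u j}"
  by (rule finite_subset[of _ "{..<n}"]) (auto dest: R_less2)

lemma R_le_top: "R u z \<Longrightarrow> z \<le> top u"
  unfolding top_def by (intro Max_ge) auto

lemma R_top: "u < n \<Longrightarrow> R u (top u)"
  using Max_in[of "{j. R u j}"] R_refl unfolding top_def by auto

lemma near_mono: "near D u \<Longrightarrow> D \<subseteq> D' \<Longrightarrow> near D' u"
  by (auto simp: near_def)

text \<open>
  The greedy choice for an undominated \<open>i\<close>: the closed neighbour of \<open>i\<close> with the largest
  neighbourhood among the vertices from \<open>i\<close> on, preferring in a tie one with a neighbour before
  \<open>i\<close>, because that neighbour is already dominated and so provides a second element of the
  dominating set at distance at most 2.
\<close>

definition key :: "nat \<Rightarrow> nat \<Rightarrow> nat" where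
  "key i x = 2 * card {z. i \<le> z \<and> R x z} + (if \<exists>z<i. R x z then 1 else 0)"

definition greedy :: "nat \<Rightarrow> nat \<Rightarrow> bool" where
  "greedy i b \<longleftrightarrow> R i b \<and> (\<forall>x. R i x \<longrightarrow> key i x \<le> key i b)"

lemma finite_R_from [simp]: "finite {z. i \<le> z \<and> R u z}"
  by (rule finite_subset[OF _ finite_R[of u]]) auto

lemma R_nested: "R i x \<Longrightarrow> R i b \<Longrightarrow> x \<le> b \<Longrightarrow> {z. i \<le> z \<and> R x z} \<subseteq> {z. i \<le> z \<and> R b z}"
  using gamma[of i _ x b] R_sym by blast

text \<open>By \<open>R_nested\<close> the neighbourhoods from \<open>i\<close> on of the closed
  neighbours of \<open>i\<close> form a chain, so one of largest cardinality contains all others.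
  The factor 2 in \<open>key\<close> prevents the bonus of 1 from outweighing a difference in
  cardinality.\<close>

lemma greedy_nbrs_subset:
  assumes "greedy i b" "R i x"
  shows "{z. i \<le> z \<and> R x z} \<subseteq> {z. i \<le> z \<and> R b z}"
proof (cases "x \<le> b")
  case True
  then show ?thesis using assms R_nested by (auto simp: greedy_def)
next
  case False
  then have sub: "{z. i \<le> z \<and> R b z} \<subseteq> {z. i \<le> z \<and> R x z}"
    using assms R_nested[of i b x] by (auto simp: greedy_def)
  have "key i x \<le> key i b" using assms by (auto simp: greedy_def)
  then have "card {z. i \<le> z \<and> R x z} \<le> card {z. i \<le> z \<and> R b z}"
    by (auto simp: key_def split: if_splits)
  then show ?thesis using card_seteq[OF _ sub] by simp
qed

definition nbrs_maximal :: "nat \<Rightarrow> nat \<Rightarrow> bool" where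
  "nbrs_maximal v u \<longleftrightarrow>
     (\<forall>x. R v x \<and> {z. R u z} \<subseteq> {z. R x z} \<longrightarrow> {z. R x z} \<subseteq> {z. R u z})"

text \<open>A competitor \<open>x\<close> whose neighbourhood contains that of \<open>b\<close> ties
  with \<open>b\<close> from \<open>i\<close> on. Any neighbour of \<open>x\<close> before
  \<open>i\<close> would have won the tie, so there is none, and the two neighbourhoods
  agree.\<close>

lemma greedy_nbrs_maximal:
  assumes "greedy i b" "\<And>z. R b z \<Longrightarrow> i \<le> z"
  shows "nbrs_maximal i b"
  unfolding nbrs_maximal_def
proof (intro allI impI; elim conjE)
  fix x assume x: "R i x" "{z. R b z} \<subseteq> {z. R x z}"
  have "{z. i \<le> z \<and> R b z} = {z. i \<le> z \<and> R x z}"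
    using greedy_nbrs_subset[OF assms(1)] x by blast
  moreover have "key i x \<le> key i b" using assms x by (auto simp: greedy_def)
  moreover have "\<not> (\<exists>z<i. R b z)" using assms(2) by force
  ultimately have "\<not> (\<exists>z<i. R x z)"
    by (auto simp: key_def split: if_splits)
  then show "{z. R x z} \<subseteq> {z. R b z}"
    using \<open>{z. i \<le> z \<and> R b z} = {z. i \<le> z \<and> R x z}\<close> by (auto simp: not_less)
qed

text \<open>
  The invariant of the greedy algorithm.  \<open>V\<close> is the set of vertices that were undominated when
  they were scanned, \<open>U v\<close> is the vertex chosen for \<open>v\<close>, and \<open>W\<close> consists of those \<open>v\<close> for which
  \<open>U v\<close> later needed a partner.  The closed neighbourhoods of the vertices in \<open>V - W\<close> together with
  the balls of radius 2 around \<open>U w\<close> for \<open>w \<in> W\<close> are disjoint; they certify optimality.  The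
  indices \<open>i\<close> and \<open>j\<close> count the vertices that have been dominated and those \<open>p\<close> for which all
  \<open>u\<close> with \<open>top u = p\<close> have been given partners.
\<close>

definition greedy_inv ::
  "nat \<Rightarrow> nat \<Rightarrow> nat set \<Rightarrow> nat set \<Rightarrow> (nat \<Rightarrow> nat) \<Rightarrow> nat set \<Rightarrow> bool" where
  "greedy_inv i j D V U W \<longleftrightarrow>
     D \<subseteq> {..<n} \<and> V \<subseteq> {..<i} \<and> W \<subseteq> V \<and> card D \<le> card V + card W \<and>
     (\<forall>v<i. dominated D v) \<and>
     (\<forall>d\<in>D. near D d \<or> j \<le> top d \<and> d \<in> U ` V) \<and>
     (\<forall>v\<in>V. R v (U v) \<and> U v \<in> D \<and> (\<forall>x z. R v x \<and> v \<le> z \<and> R x z \<longrightarrow> R (U v) z)) \<and>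
     (\<forall>v\<in>V. near D (U v) \<or>
        nbrs_maximal v (U v)) \<and>
     (\<forall>w\<in>W. top (U w) < j \<and> top (top (U w)) \<in> D \<and>
        nbrs_maximal w (U w)) \<and>
     (\<forall>v\<in>V. \<forall>v'\<in>V. v \<noteq> v' \<longrightarrow> \<not> (\<exists>a. R v a \<and> R v' a)) \<and>
     (\<forall>w\<in>W. \<forall>v\<in>V. w \<noteq> v \<longrightarrow> \<not> (\<exists>z a. R (U w) z \<and> R z a \<and> R v a)) \<and>
     (\<forall>w\<in>W. \<forall>w'\<in>W. w \<noteq> w' \<longrightarrow>
        \<not> (\<exists>z a z'. R (U w) z \<and> R z a \<and> R (U w') z' \<and> R z' a))"

text \<open>The conclusions are cited by number below: (9) says that \<open>U v\<close> dominates
  whatever any closed neighbour of \<open>v\<close> dominates from \<open>v\<close> on, (10) and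
  (13) concern maximality, (11) and (12) the partners, and (14) to (16) the disjointness of the
  packing.\<close>

lemma greedy_invD:
  assumes "greedy_inv i j D V U W"
  shows "D \<subseteq> {..<n}" "V \<subseteq> {..<i}" "W \<subseteq> V" "card D \<le> card V + card W"
    "v < i \<Longrightarrow> dominated D v"
    "d \<in> D \<Longrightarrow> near D d \<or> j \<le> top d \<and> d \<in> U ` V"
    "v \<in> V \<Longrightarrow> R v (U v)" "v \<in> V \<Longrightarrow> U v \<in> D"
    "v \<in> V \<Longrightarrow> R v x \<Longrightarrow> v \<le> z \<Longrightarrow> R x z \<Longrightarrow> R (U v) z"
    "v \<in> V \<Longrightarrow> near D (U v) \<or>
        nbrs_maximal v (U v)"
    "w \<in> W \<Longrightarrow> top (U w) < j" "w \<in> W \<Longrightarrow> top (top (U w)) \<in> D"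
    "w \<in> W \<Longrightarrow> nbrs_maximal w (U w)"
    "v \<in> V \<Longrightarrow> v' \<in> V \<Longrightarrow> v \<noteq> v' \<Longrightarrow> R v a \<Longrightarrow> R v' a \<Longrightarrow> False"
    "w \<in> W \<Longrightarrow> v \<in> V \<Longrightarrow> w \<noteq> v \<Longrightarrow> R (U w) z \<Longrightarrow> R z a \<Longrightarrow> R v a \<Longrightarrow> False"
    "w \<in> W \<Longrightarrow> w' \<in> W \<Longrightarrow> w \<noteq> w' \<Longrightarrow> R (U w) z \<Longrightarrow> R z a \<Longrightarrow> R (U w') z' \<Longrightarrow> R z' a \<Longrightarrow> False"
proof -
  note J = assms[unfolded greedy_inv_def]
  show "D \<subseteq> {..<n}"
    using J[THEN conjunct1] by blast
  show "V \<subseteq> {..<i}"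
    using J[THEN conjunct2, THEN conjunct1] by blast
  show "W \<subseteq> V"
    using J[THEN conjunct2, THEN conjunct2, THEN conjunct1] by blast
  show "card D \<le> card V + card W"
    using J[THEN conjunct2, THEN conjunct2, THEN conjunct2, THEN conjunct1] by blast
  show "dominated D v" if "v < i"
    using J[THEN conjunct2, THEN conjunct2, THEN conjunct2, THEN conjunct2, THEN conjunct1] that by blast
  show "near D d \<or> j \<le> top d \<and> d \<in> U ` V" if "d \<in> D"
    using J[THEN conjunct2, THEN conjunct2, THEN conjunct2, THEN conjunct2, THEN conjunct2, THEN conjunct1] that by blast
  show "R v (U v)" if "v \<in> V"
    using J[THEN conjunct2, THEN conjunct2, THEN conjunct2, THEN conjunct2, THEN conjunct2, THEN conjunct2, THEN conjunct1] that by blast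
  show "U v \<in> D" if "v \<in> V"
    using J[THEN conjunct2, THEN conjunct2, THEN conjunct2, THEN conjunct2, THEN conjunct2, THEN conjunct2, THEN conjunct1] that by blast
  show "R (U v) z" if "v \<in> V" "R v x" "v \<le> z" "R x z"
    using J[THEN conjunct2, THEN conjunct2, THEN conjunct2, THEN conjunct2, THEN conjunct2, THEN conjunct2, THEN conjunct1] that by blast
  show "near D (U v) \<or>
        nbrs_maximal v (U v)" if "v \<in> V"
    using J[THEN conjunct2, THEN conjunct2, THEN conjunct2, THEN conjunct2, THEN conjunct2, THEN conjunct2, THEN conjunct2, THEN conjunct1] that by blast
  show "top (U w) < j" if "w \<in> W"
    using J[THEN conjunct2, THEN conjunct2, THEN conjunct2, THEN conjunct2, THEN conjunct2, THEN conjunct2, THEN conjunct2, THEN conjunct2, THEN conjunct1] that by blast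
  show "top (top (U w)) \<in> D" if "w \<in> W"
    using J[THEN conjunct2, THEN conjunct2, THEN conjunct2, THEN conjunct2, THEN conjunct2, THEN conjunct2, THEN conjunct2, THEN conjunct2, THEN conjunct1] that by blast
  show "nbrs_maximal w (U w)" if "w \<in> W"
    using J[THEN conjunct2, THEN conjunct2, THEN conjunct2, THEN conjunct2, THEN conjunct2, THEN conjunct2, THEN conjunct2, THEN conjunct2, THEN conjunct1] that by blast
  show "False" if "v \<in> V" "v' \<in> V" "v \<noteq> v'" "R v a" "R v' a"
    using J[THEN conjunct2, THEN conjunct2, THEN conjunct2, THEN conjunct2, THEN conjunct2, THEN conjunct2, THEN conjunct2, THEN conjunct2, THEN conjunct2, THEN conjunct1] that by blast
  show "False" if "w \<in> W" "v \<in> V" "w \<noteq> v" "R (U w) z" "R z a" "R v a"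
    using J[THEN conjunct2, THEN conjunct2, THEN conjunct2, THEN conjunct2, THEN conjunct2, THEN conjunct2, THEN conjunct2, THEN conjunct2, THEN conjunct2, THEN conjunct2, THEN conjunct1] that by blast
  show "False" if "w \<in> W" "w' \<in> W" "w \<noteq> w'" "R (U w) z" "R z a" "R (U w') z'" "R z' a"
    using J[THEN conjunct2, THEN conjunct2, THEN conjunct2, THEN conjunct2, THEN conjunct2, THEN conjunct2, THEN conjunct2, THEN conjunct2, THEN conjunct2, THEN conjunct2, THEN conjunct2] that by blast
qed

section \<open>Preservation of the greedy invariant\<close>

lemma greedy_inv_start: "greedy_inv 0 0 {} {} U {}"
  by (simp add: greedy_inv_def)

text \<open>The rows \<open>u\<close> and \<open>a\<close> and the columns \<open>z\<close> and
  \<open>top u\<close> form the configuration of \<open>gamma\<close>. Thus the part of the ball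
  beyond \<open>u\<close> lies in the closed neighbourhood of the single vertex
  \<open>top u\<close>.\<close>

lemma R_top_from_ball:
  assumes "R u z" "R z a" "u \<le> a"
  shows "R a (top u)"
  using gamma[of u a z "top u"] assms R_le_top R_top R_sym R_less by blast

lemma greedy_inv_choose:
  assumes inv: "greedy_inv i i D V U W" and "i < n" and nd: "\<not> dominated D i" and b: "greedy i b"
  shows "b \<notin> D" "greedy_inv (Suc i) i (insert b D) (insert i V) (U(i := b)) W"
proof -
  note I = greedy_invD[OF inv]
  have Rib: "R i b" using b by (simp add: greedy_def)
  show bD: "b \<notin> D" using nd Rib by (auto simp: dominated_def)
  have iV: "i \<notin> V" using I(2) by auto
  have U: "(U(i := b)) v = U v" if "v \<in> V" for v using that iV by auto
  have fin: "finite V" "finite D" using I(1,2) by (auto intro: finite_subset)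
  \<comment> \<open>A vertex \<open>a\<close> common to the ball and the closed neighbourhood of
    \<open>i\<close> would make \<open>i\<close> dominated: by \<open>U w\<close> if
    \<open>a\<close> is at most \<open>U w\<close>, and otherwise by \<open>top (top (U w))\<close>,
    which is in \<open>D\<close> by the invariant.\<close>
  have b1: False if "w \<in> W" "R (U w) z" "R z a" "R i a" for w z a
  proof -
    let ?u = "U w"
    have w: "w \<in> V" using that I(3) by auto
    have u: "?u \<in> D" "?u < n" using I(8)[OF w] I(1) by auto
    have le: "z \<le> top ?u" "top ?u < i" using R_le_top that I(11) by auto
    show False
    proof (cases "a \<le> ?u")
      case True
      then have "R i ?u" using gamma[of z i a ?u] le that R_sym by auto
      with u nd show False by (auto simp: dominated_def)
    next
      case False
      then have "R (top ?u) a" using R_top_from_ball[of ?u z a] that R_sym by auto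
      then have "R i (top (top ?u))"
        using gamma[of "top ?u" i a "top (top ?u)"] le that R_le_top R_top R_less by auto
      with I(12)[OF \<open>w \<in> W\<close>] nd show False by (auto simp: dominated_def)
    qed
  qed
  \<comment> \<open>Because \<open>i\<close> comes after \<open>v\<close>, a common closed neighbour
    \<open>a\<close> would force \<open>U v\<close> to dominate \<open>i\<close>.\<close>
  have a1: False if "v \<in> V" "R v a" "R i a" for v a
  proof -
    have "v \<le> i" using I(2) that by auto
    then have "R i (U v)" using I(9)[of v a i] that R_sym by blast
    with I(8)[OF that(1)] nd show False by (auto simp: dominated_def)
  qed
  have new: "near (insert b D) b \<or>
      nbrs_maximal i b"
  proof (cases "\<exists>z<i. R b z")
    case True
    then obtain z where z: "z < i" "R b z" by blast
    then obtain d where "d \<in> D" "R z d" using I(5) by (auto simp: dominated_def)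
    with z bD show ?thesis by (auto simp: near_def)
  next
    case False
    then show ?thesis using greedy_nbrs_maximal[OF b] by (meson not_le)
  qed
  have "i \<le> top b" using R_le_top Rib R_sym by blast
  moreover have "card (insert b D) \<le> card (insert i V) + card W"
    using I(4) bD iV fin by simp
  moreover have "R b z" if "R i x" "i \<le> z" "R x z" for x z
    using greedy_nbrs_subset[OF b \<open>R i x\<close>] that by auto
  ultimately show "greedy_inv (Suc i) i (insert b D) (insert i V) (U(i := b)) W"
    unfolding greedy_inv_def
  proof (intro conjI)
    show "insert b D \<subseteq> {..<n}" using I(1) R_less2[OF Rib] by auto
    show "insert i V \<subseteq> {..<Suc i}" "W \<subseteq> insert i V" using I(2,3) by auto
    show "\<forall>v<Suc i. dominated (insert b D) v"
      using I(5) Rib by (auto simp: dominated_def less_Suc_eq)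
    show "\<forall>d\<in>insert b D. near (insert b D) d \<or> i \<le> top d \<and> d \<in> (U(i := b)) ` insert i V"
      using I(6) near_mono[of D _ "insert b D"] \<open>i \<le> top b\<close> iV by (auto simp: image_iff)
    have "near (insert b D) ((U(i := b)) v) \<or> nbrs_maximal v ((U(i := b)) v)"
      if v: "v \<in> insert i V" for v
    proof (cases "v = i")
      case True
      then show ?thesis using new by simp
    next
      case False
      then show ?thesis using I(10)[of v] v near_mono[of D "U v" "insert b D"] by auto
    qed
    then show "\<forall>v\<in>insert i V. near (insert b D) ((U(i := b)) v) \<or> nbrs_maximal v ((U(i := b)) v)"
      by blast
    have UW: "(U(i := b)) w = U w" if "w \<in> W" for w using that U I(3) by blast
    show "\<forall>w\<in>W. top ((U(i := b)) w) < i \<and> top (top ((U(i := b)) w)) \<in> insert b D \<and>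
        nbrs_maximal w ((U(i := b)) w)"
      using I(11-13) UW by simp
    show "\<forall>v\<in>insert i V. \<forall>v'\<in>insert i V. v \<noteq> v' \<longrightarrow> \<not> (\<exists>a. R v a \<and> R v' a)"
      using I(14) a1 by blast
    show "\<forall>w\<in>W. \<forall>v\<in>insert i V. w \<noteq> v \<longrightarrow>
        \<not> (\<exists>z a. R ((U(i := b)) w) z \<and> R z a \<and> R v a)"
    proof (intro ballI impI)
      fix w v assume "w \<in> W" "v \<in> insert i V" "w \<noteq> v"
      then show "\<not> (\<exists>z a. R ((U(i := b)) w) z \<and> R z a \<and> R v a)"
        unfolding UW[OF \<open>w \<in> W\<close>] using I(15)[of w v] b1[of w] by blast
    qed
    show "\<forall>w\<in>W. \<forall>w'\<in>W. w \<noteq> w' \<longrightarrow>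
        \<not> (\<exists>z a z'. R ((U(i := b)) w) z \<and> R z a \<and> R ((U(i := b)) w') z' \<and> R z' a)"
    proof (intro ballI impI)
      fix w w' assume "w \<in> W" "w' \<in> W" "w \<noteq> w'"
      then show "\<not> (\<exists>z a z'. R ((U(i := b)) w) z \<and> R z a \<and> R ((U(i := b)) w') z' \<and> R z' a)"
        unfolding UW[OF \<open>w \<in> W\<close>] UW[OF \<open>w' \<in> W\<close>] using I(16)[of w w'] by blast
    qed
  qed (use I(7-9) Rib iV in auto)
qed

lemma greedy_inv_dominated:
  assumes "greedy_inv i i D V U W" "dominated D i"
  shows "greedy_inv (Suc i) i D V U W"
proof -
  note I = greedy_invD[OF assms(1)]
  have "V \<subseteq> {..<Suc i}" "\<forall>v<Suc i. dominated D v"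
    using I(2,5) assms(2) by (auto simp: less_Suc_eq)
  with assms(1) show ?thesis
    unfolding greedy_inv_def by (elim conjE) (intro conjI; assumption)
qed

lemma greedy_inv_no_partner:
  assumes "greedy_inv (Suc i) i D V U W" "\<And>u. u \<in> D \<Longrightarrow> top u = i \<Longrightarrow> near D u"
  shows "greedy_inv (Suc i) (Suc i) D V U W"
proof -
  note I = greedy_invD[OF assms(1)]
  have "\<forall>d\<in>D. near D d \<or> Suc i \<le> top d \<and> d \<in> U ` V"
    using I(6) assms(2) by (metis Suc_leI le_neq_implies_less)
  moreover have "\<forall>w\<in>W. top (U w) < Suc i \<and> top (top (U w)) \<in> D \<and> nbrs_maximal w (U w)"
    using I(11-13) less_SucI by blast
  ultimately show ?thesis
    using assms(1) unfolding greedy_inv_def by (elim conjE) (intro conjI; assumption)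
qed

text \<open>As \<open>u\<close> is far from the rest of \<open>D\<close>, any overlap of its ball
  with another set of the packing is refuted by finding an element of \<open>D\<close> other than
  \<open>u\<close> within distance 2 of \<open>u\<close>. In the exceptional case
  \<open>top i = u\<close>, the vertex \<open>top (top u)\<close> required by the invariant is
  \<open>u\<close> itself and already present, so any proper neighbour of \<open>u\<close> may be
  the partner.\<close>

lemma greedy_inv_partner:
  assumes inv: "greedy_inv (Suc i) i D V U W" and u: "u \<in> D" "top u = i" and far: "\<not> near D u"
    and g: "if top i = u then R u g \<and> g \<noteq> u else g = top i"
  shows "g \<notin> D" "\<exists>W'. greedy_inv (Suc i) (Suc i) (insert g D) V U W'"
proof -
  note I = greedy_invD[OF inv]
  have un: "u < n" using u I(1) by auto
  have Rui: "R u i" using R_top[OF un] u by simp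
  have Rit: "R i (top i)" using R_top R_less2[OF Rui] by blast
  have gu: "g \<noteq> u" "\<exists>y. R u y \<and> R y g"
    using g Rui Rit R_refl[OF un] by (auto split: if_splits)
  have ns: False if "d \<in> D" "d \<noteq> u" "R u y" "R y d" for d y
    using that far by (auto simp: near_def)
  show gD: "g \<notin> D" using gu ns by blast
  have ttD: "top i \<in> insert g D" using g u by (auto split: if_splits)
  obtain w where w: "w \<in> V" "u = U w" using I(6)[OF u(1)] far by auto
  have inj: "U v \<noteq> u" if "v \<in> V" "v \<noteq> w" for v
    using that I(7,14) w by metis
  \<comment> \<open>Members of \<open>W\<close> satisfy \<open>top (U w) < i\<close>, whereas here
    \<open>top u = i\<close>.\<close>
  have wW: "w \<notin> W" using I(11)[of w] u w by auto
  have fin: "finite V" "finite W" "finite D"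
    using I(1-3) by (auto intro: finite_subset)
  have nearg: "near (insert g D) u" "near (insert g D) g"
    using gu u(1) R_sym unfolding near_def by (blast, metis insertI2)
  \<comment> \<open>In each case \<open>U v\<close> and \<open>u\<close> get a common closed
    neighbour: \<open>z\<close> if \<open>v\<close> is at most \<open>z\<close>, \<open>v\<close>
    itself if \<open>z < v\<close> and \<open>a\<close> is at most \<open>u\<close>, and
    \<open>i\<close> if \<open>a\<close> is at least \<open>u\<close>.\<close>
  have b2: False if v: "v \<in> V" "v \<noteq> w" and zs: "R u z" "R z a" "R v a" for v z a
  proof -
    let ?u' = "U v"
    have u': "?u' \<in> D" "?u' \<noteq> u" using I(8) v inj by auto
    have "v \<le> i" using I(2) v by auto
    consider "v \<le> z" | "z < v" "a \<le> u" | "u \<le> a" by linarith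
    then show False
    proof cases
      case 1
      then have "R ?u' z" using I(9)[of v a z] v zs R_sym by blast
      then show False using ns[OF u'] zs R_sym by blast
    next
      case 2
      then have "R v u" using gamma[of z v a u] zs R_sym by auto
      then show False using ns[OF u', of v] I(7) v R_sym by blast
    next
      case 3
      then have "R a i" using R_top_from_ball[of u z a] zs u by auto
      then have "R ?u' i" using I(9)[of v a i] v zs \<open>v \<le> i\<close> by auto
      then show False using ns[OF u' Rui] R_sym by blast
    qed
  qed
  \<comment> \<open>The offending element of \<open>D\<close> is \<open>U v\<close> or the vertex
    \<open>top (top (U v))\<close>. Which one is found depends on the side of \<open>U v\<close> and
    of \<open>u\<close> on which the common vertex \<open>a\<close> lies.\<close>
  have c: False if v: "v \<in> W" and zs: "R (U v) z" "R z a" "R u z'" "R z' a" for v z z' a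
  proof -
    let ?u = "U v" let ?p = "top (U v)" let ?g = "top (top (U v))"
    have vV: "v \<in> V" "v \<noteq> w" using v I(3) wW by auto
    have v': "?u \<in> D" "?u \<noteq> u" using I(8) vV inj by auto
    have Rup: "R ?u ?p" using R_top I(7) vV R_less2 by blast
    then have Rpg: "R ?p ?g" using R_top R_less2 by blast
    have p: "z \<le> ?p" "?p < i" "z' \<le> i" using R_le_top zs I(11) v u by auto
    \<comment> \<open>If \<open>?g\<close> happens to be \<open>u\<close>, it is no second element
      of \<open>D\<close>; but then \<open>?p\<close> is a common closed neighbour of
      \<open>U v\<close> and \<open>u\<close>.\<close>
    have nog: False if "R y ?g" "R u y" for y
    proof (cases "?g = u")
      case True
      with Rpg have "R u ?p" using R_sym by simp
      then show False using ns[OF v'] Rup R_sym by blast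
    next
      case False
      then show False using ns[OF I(12)[OF v]] that by blast
    qed
    show False
    proof (cases "a \<le> ?u")
      case True
      show False
      proof (cases "z \<le> z'")
        case True
        then have "R z' ?u" using gamma[of z z' a ?u] \<open>a \<le> ?u\<close> zs R_sym by auto
        then show False using ns[OF v'] zs by blast
      next
        case False
        show False
        proof (cases "a \<le> u")
          case True
          then have "R z u" using gamma[of z' z a u] False zs R_sym by auto
          then show False using ns[OF v'] zs R_sym by blast
        next
          case False
          then have "R i a" using R_top_from_ball[of u z' a] zs u R_sym by auto
          then have "R i ?u" using gamma[of z i a ?u] \<open>a \<le> ?u\<close> zs R_sym p by auto
          then show False using ns[OF v'] Rui by blast
        qed
      qed
    next
      case False
      then have Rpa: "R ?p a" using R_top_from_ball[of ?u z a] zs R_sym by auto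
      have ag: "a \<le> ?g" using Rpa R_le_top by blast
      show False
      proof (cases "?p \<le> z'")
        case True
        then have "R z' ?g" using gamma[of ?p z' a ?g] ag Rpa Rpg zs by auto
        then show False using nog zs by blast
      next
        case zp: False
        show False
        proof (cases "a \<le> u")
          case True
          then have "R ?p u" using gamma[of z' ?p a u] zp zs Rpa R_sym by auto
          then show False using ns[OF v'] Rup R_sym by blast
        next
          case False
          then have "R i a" using R_top_from_ball[of u z' a] zs u R_sym by auto
          then have "R i ?g" using gamma[of ?p i a ?g] ag Rpa Rpg p by auto
          then show False using nog Rui by blast
        qed
      qed
    qed
  qed
  have "greedy_inv (Suc i) (Suc i) (insert g D) V U (insert w W)"
    unfolding greedy_inv_def
  proof (intro conjI)
    show "insert g D \<subseteq> {..<n}" using I(1) gu R_less2 by auto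
    show "V \<subseteq> {..<Suc i}" "insert w W \<subseteq> V" using I(2,3) w by auto
    show "card (insert g D) \<le> card V + card (insert w W)"
      using I(4) gD wW fin by simp
    show "\<forall>v<Suc i. dominated (insert g D) v"
      using I(5) by (auto simp: dominated_def)
    show "\<forall>d\<in>insert g D. near (insert g D) d \<or> Suc i \<le> top d \<and> d \<in> U ` V"
    proof
      fix d assume "d \<in> insert g D"
      then consider "d = g" | "d = u" | "d \<in> D" "near D d" | "d \<in> D" "d \<noteq> u" "\<not> near D d" by blast
      then show "near (insert g D) d \<or> Suc i \<le> top d \<and> d \<in> U ` V"
      proof cases
        case 4
        \<comment> \<open>Another such \<open>d\<close> would share the closed neighbour
          \<open>i\<close> with \<open>u\<close>, so at most one vertex needs a partner at
          \<open>i\<close>.\<close>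
        have "top d \<noteq> i"
        proof
          assume "top d = i"
          then have "R i d" using R_top[of d] I(1) 4 R_sym by auto
          then show False using ns 4 Rui by blast
        qed
        then show ?thesis using I(6)[of d] 4 by auto
      qed (use nearg near_mono[of D _ "insert g D"] in auto)
    qed
    show "\<forall>v\<in>V. R v (U v) \<and> U v \<in> insert g D \<and> (\<forall>x z. R v x \<and> v \<le> z \<and> R x z \<longrightarrow> R (U v) z)"
      using I(7-9) by auto
    show "\<forall>v\<in>V. near (insert g D) (U v) \<or>
      nbrs_maximal v (U v)"
      using I(10) near_mono[of D _ "insert g D"] by (meson subset_insertI)
    show "\<forall>w\<in>insert w W. top (U w) < Suc i \<and> top (top (U w)) \<in> insert g D \<and>
      nbrs_maximal w (U w)"
    proof
      fix w' assume "w' \<in> insert w W"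
      then consider "w' = w" | "w' \<in> W" by blast
      then show "top (U w') < Suc i \<and> top (top (U w')) \<in> insert g D \<and>
      nbrs_maximal w' (U w')"
      proof cases
        case 1
        then show ?thesis using I(10)[OF w(1)] w far u ttD by auto
      next
        case 2
        then show ?thesis using I(11-13)[of w'] by (auto simp: less_SucI)
      qed
    qed
    show "\<forall>v\<in>V. \<forall>v'\<in>V. v \<noteq> v' \<longrightarrow> \<not> (\<exists>a. R v a \<and> R v' a)"
      using I(14) by blast
    show "\<forall>w\<in>insert w W. \<forall>v\<in>V. w \<noteq> v \<longrightarrow> \<not> (\<exists>z a. R (U w) z \<and> R z a \<and> R v a)"
      using I(15) b2 w by blast
    show "\<forall>v\<in>insert w W. \<forall>v'\<in>insert w W. v \<noteq> v' \<longrightarrow>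
        \<not> (\<exists>z a z'. R (U v) z \<and> R z a \<and> R (U v') z' \<and> R z' a)"
      using I(16) c w by blast
  qed
  then show "\<exists>W'. greedy_inv (Suc i) (Suc i) (insert g D) V U W'" by blast
qed

section \<open>Feasibility and optimality of the final set\<close>

lemma greedy_inv_semitotal:
  assumes "greedy_inv n n D V U W"
  shows "semitotal D"
proof -
  note I = greedy_invD[OF assms]
  have "near D d" if "d \<in> D" for d
  proof -
    have "top d < n" using that I(1) R_top R_less2 by blast
    with I(6)[OF that] show ?thesis by auto
  qed
  then show ?thesis using I(1,5) by (auto simp: semitotal_def)
qed

lemma greedy_inv_minimum:
  assumes inv: "greedy_inv n n D V U W" and "semitotal D'"
  shows "card D \<le> card D'"
proof -
  note I = greedy_invD[OF inv]
  define T where "T v = (if v \<in> W then {a. \<exists>z. R (U v) z \<and> R z a} else {a. R v a})" for v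
  have D': "D' \<subseteq> {..<n}" "finite D'"
    using assms(2) by (auto simp: semitotal_def intro: finite_subset)
  have dom: "\<exists>x\<in>D'. R v x" if "v < n" for v
    using assms(2) that by (auto simp: semitotal_def dominated_def)
  \<comment> \<open>Let \<open>x\<close> in \<open>D'\<close> dominate \<open>w\<close>. If the
    closed neighbourhood of \<open>x\<close> lies in that of \<open>U w\<close>, the companion of
    \<open>x\<close> lies in the ball. Otherwise maximality yields a \<open>z\<close> in the
    neighbourhood of \<open>U w\<close> but not in that of \<open>x\<close>, and its dominator is a
    second vertex.\<close>
  have two: "2 \<le> card (D' \<inter> T w)" if w: "w \<in> W" for w
  proof -
    have wV: "w \<in> V" using w I(3) by auto
    then have Rwu: "R w (U w)" using I(7) by auto
    obtain x where x: "x \<in> D'" "R w x" using dom R_less[OF Rwu] by auto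
    have xT: "x \<in> T w" using w x Rwu R_sym by (auto simp: T_def)
    have "\<exists>y\<in>D'. y \<noteq> x \<and> y \<in> T w"
    proof (cases "{z. R x z} \<subseteq> {z. R (U w) z}")
      case True
      obtain y where "y \<in> D'" "y \<noteq> x" "\<exists>z. R x z \<and> R z y"
        using assms(2) x(1) unfolding semitotal_def near_def by blast
      with True w show ?thesis by (auto simp: T_def)
    next
      case False
      then obtain z where z: "R (U w) z" "\<not> R x z" using I(13)[OF w] x(2) by (auto simp: nbrs_maximal_def)
      obtain y where "y \<in> D'" "R z y" using dom R_less2[OF z(1)] by auto
      moreover from this z have "y \<noteq> x" using R_sym by blast
      ultimately show ?thesis using z w by (auto simp: T_def)
    qed
    then obtain y where "y \<in> D'" "y \<noteq> x" "y \<in> T w" by blast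
    then have "card {x, y} \<le> card (D' \<inter> T w)"
      using D' x xT by (intro card_mono) auto
    with \<open>y \<noteq> x\<close> show ?thesis by simp
  qed
  have one: "1 \<le> card (D' \<inter> T v)" if v: "v \<in> V" "v \<notin> W" for v
  proof -
    have "v < n" using v I(2) by auto
    then have "D' \<inter> T v \<noteq> {}" using dom v by (auto simp: T_def)
    then show ?thesis using D'(2) by (simp add: Suc_le_eq card_gt_0_iff)
  qed
  have disj: "T v \<inter> T v' = {}" if "v \<in> V" "v' \<in> V" "v \<noteq> v'" for v v'
  proof -
    have False if "a \<in> T v" "a \<in> T v'" for a
      using that \<open>v \<in> V\<close> \<open>v' \<in> V\<close> \<open>v \<noteq> v'\<close> I(14)[of v v' a] I(15)[of v v'] I(15)[of v' v] I(16)[of v v']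
      by (auto simp: T_def split: if_splits)
    then show ?thesis by blast
  qed
  have finV: "finite V" "finite W" using I(2,3) by (auto intro: finite_subset)
  have "card V + card W = (\<Sum>v\<in>V. 1) + (\<Sum>v\<in>V. if v \<in> W then 1 else 0)"
    using I(3) finV by (simp add: sum.If_cases Int_absorb1)
  also have "\<dots> = (\<Sum>v\<in>V. if v \<in> W then 2 else 1)"
    by (subst sum.distrib[symmetric]) (auto intro: sum.cong)
  also have "\<dots> \<le> (\<Sum>v\<in>V. card (D' \<inter> T v))"
    using one two by (intro sum_mono) auto
  also have "\<dots> = card (\<Union>v\<in>V. D' \<inter> T v)"
    using finV D' disj by (subst card_UN_disjoint) auto
  also have "\<dots> \<le> card D'" using D' by (intro card_mono) auto
  finally show ?thesis using I(4) by simp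
qed

end

section \<open>The program\<close>

text \<open>
  Vertices are represented by their positions in the ordering.  Scalars: 2 and 3 hold the constants
  1 and 0, 4 the number of vertices, 5 the vertex being scanned, 6 to 8 belong to the inner loops
  (counter, limit, test), 9 is the test of the outer loop.  Arrays: 0 and 1 the ordering and its
  inverse, 2 and 3 the limits of the segment of array 4 holding the closed neighbourhood, 5 the
  last closed neighbour, 6 the key of the greedy choice and 7 by how much it next decreases,
  8 the successor of the first element that dominated the vertex (0 if there is none), and 9, at
  index \<open>d + 1\<close>, whether the chosen vertex \<open>d\<close> has a partner.
\<close>

definition For :: "nat \<Rightarrow> nat \<Rightarrow> nat \<Rightarrow> com \<Rightarrow> com" where
  "For e l t c = (Minus t l e ;; Loop t (c ;; Plus e e 2 ;; Minus t l e))"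

definition read_order :: com where
  "read_order = (Lit 2 1 ;; Inp 4 ;; Lit 5 0 ;; For 5 4 9 (Inp 10 ;; Put 0 5 10 ;; Put 1 10 5))"

definition read_list :: com where
  "read_list =
     (For 16 7 8 (Inp 15 ;; Get 11 1 15 ;; Put 4 16 11 ;; Minus 18 11 12 ;;
        Cond 18 (Plus 12 11 3) (Lit 18 0)))"

text \<open>Scalar 16 is the next free cell of array 4. Each vertex is stored last in its own
  segment, so the first cell holds a proper neighbour. Twice the size of the segment is the initial
  key, since nothing precedes position 0.\<close>

definition read_graph :: com where
  "read_graph =
     (Lit 16 0 ;; Lit 5 0 ;;
      For 5 4 9
       (Inp 17 ;; Get 10 1 5 ;; Put 2 10 16 ;; Plus 12 10 3 ;; Plus 7 16 17 ;;
        read_list ;;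
        Put 4 16 10 ;; Plus 16 16 2 ;; Put 3 10 16 ;; Put 5 10 12 ;;
        Plus 17 17 2 ;; Plus 17 17 17 ;; Put 6 10 17 ;; Put 7 10 2))"

text \<open>Array 8 stores successors of vertices, and array 9 is shifted by one so that such an
  entry is directly an index into it.\<close>

definition insert_chosen :: com where
  "insert_chosen =
     (Get 15 0 12 ;; Outp 15 ;; Plus 14 12 2 ;; Get 6 2 12 ;; Get 7 3 12 ;;
      For 6 7 8 (Get 11 4 6 ;; Get 15 8 11 ;;
        Cond 15 (Put 9 14 2 ;; Put 9 15 2) (Put 8 11 14)))"

definition choose_best :: com where
  "choose_best =
     (Lit 12 0 ;; Lit 13 0 ;; Get 6 2 5 ;; Get 7 3 5 ;;
      For 6 7 8 (Get 10 4 6 ;; Get 15 6 10 ;; Minus 18 15 13 ;;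
        Cond 18 (Plus 12 10 3 ;; Plus 13 15 3) (Lit 18 0)))"

definition dominate :: com where
  "dominate = (Get 14 8 5 ;; Cond 14 (Lit 18 0) (choose_best ;; insert_chosen))"

text \<open>For the recorded dominator \<open>u\<close> of the scanned \<open>p\<close>,
  \<open>p\<close> is at most \<open>top u\<close> and \<open>u\<close> is at most
  \<open>top p\<close>. Hence a truncated difference that vanishes means equality in both
  tests.\<close>

definition give_partner :: com where
  "give_partner =
     (Get 14 8 5 ;; Get 15 9 14 ;;
      Cond 15 (Lit 18 0)
       (Minus 14 14 2 ;; Get 15 5 14 ;; Minus 18 15 5 ;;
        Cond 18 (Lit 18 0)
         (Get 12 5 5 ;; Minus 18 12 14 ;;
          Cond 18 (Lit 18 0) (Get 6 2 14 ;; Get 12 4 6) ;;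
          insert_chosen)))"

definition update_keys :: com where
  "update_keys =
     (Get 6 2 5 ;; Get 7 3 5 ;;
      For 6 7 8 (Get 10 4 6 ;; Get 15 6 10 ;; Get 18 7 10 ;; Minus 15 15 18 ;; Put 6 10 15 ;;
        Lit 18 2 ;; Put 7 10 18))"

definition scan :: com where
  "scan = (Lit 5 0 ;; For 5 4 9 (dominate ;; give_partner ;; update_keys))"

definition semitotal_program :: com where
  "semitotal_program = (read_order ;; read_graph ;; scan)"

lemma wf_semitotal_program: "wf_com semitotal_program"
  by (simp add: semitotal_program_def read_order_def read_graph_def read_list_def scan_def
      dominate_def give_partner_def update_keys_def choose_best_def insert_chosen_def For_def)

lemma wp_For:
  assumes "e \<noteq> 2" "t \<noteq> 2" "t \<noteq> e" "t \<noteq> l" "e \<noteq> l"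
    and s: "sc s e = a" "sc s l = b" "sc s 2 = 1" "a \<le> b"
    and init: "I a (s\<lparr>sc := (sc s)(t := b - a), tm := tm s + 1\<rparr>)"
    and step: "\<And>j s. I j s \<Longrightarrow> sc s e = j \<Longrightarrow> sc s l = b \<Longrightarrow> sc s 2 = 1 \<Longrightarrow> a \<le> j \<Longrightarrow> j < b \<Longrightarrow>
       wp c (\<lambda>s'. sc s' e = j \<and> sc s' l = b \<and> sc s' 2 = 1 \<and>
         I (Suc j) (s'\<lparr>sc := (sc s')(e := Suc j, t := b - Suc j), tm := tm s' + 2\<rparr>)) (tick 3 s)"
    and exit: "\<And>s. I b s \<Longrightarrow> sc s e = b \<Longrightarrow> sc s l = b \<Longrightarrow> sc s 2 = 1 \<Longrightarrow> Q (tick 3 s)"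
  shows "wp (For e l t c) Q s"
proof -
  let ?J = "\<lambda>j s. I j s \<and> sc s e = j \<and> sc s l = b \<and> sc s 2 = 1 \<and> sc s t = b - j"
  have "wp (Loop t (c ;; Plus e e 2 ;; Minus t l e)) Q (s\<lparr>sc := (sc s)(t := b - a), tm := tm s + 1\<rparr>)"
  proof (rule wp_Loop[where I = ?J and a = a and b = b])
    show "?J a (s\<lparr>sc := (sc s)(t := b - a), tm := tm s + 1\<rparr>)"
      using assms(1-5) s init by auto
  next
    fix j s' assume J: "?J j s'" "a \<le> j" "j < b"
    have "wp c (wp (Plus e e 2 ;; Minus t l e) (?J (Suc j))) (tick 3 s')"
      by (rule wp_mono[OF step[of j s']]) (use J assms(1-5) in auto)
    then show "sc s' t > 0 \<and> wp (c ;; Plus e e 2 ;; Minus t l e) (?J (Suc j)) (tick 3 s')"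
      using J by simp
  qed (use s exit in auto)
  then show ?thesis using s by (simp add: For_def)
qed

section \<open>Contents of the arrays and verification of the scan\<close>

locale greedy_ram = gamma_free +
  fixes L :: "nat \<Rightarrow> nat list" and \<alpha> :: "nat list"
  assumes set_L: "i < n \<Longrightarrow> set (L i) = {j. R i j}"
    and distinct_L: "i < n \<Longrightarrow> distinct (L i)"
    and hd_L: "i < n \<Longrightarrow> L i ! 0 \<noteq> i"
begin

definition loaded :: "(nat \<Rightarrow> nat \<Rightarrow> nat) \<Rightarrow> bool" where
  "loaded M \<longleftrightarrow> (\<forall>i<n. M 0 i = \<alpha> ! i \<and> M 3 i = M 2 i + length (L i) \<and> M 5 i = top i \<and>
     (\<forall>k<length (L i). M 4 (M 2 i + k) = L i ! k))"

definition visited :: "(nat \<Rightarrow> nat \<Rightarrow> nat) \<Rightarrow> nat \<Rightarrow> nat \<Rightarrow> nat set" where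
  "visited M b j = set (take (j - M 2 b) (L b))"

lemma loaded_cong:
  assumes "loaded M" "\<And>k. k \<in> {0, 2, 3, 4, 5} \<Longrightarrow> M' k = M k"
  shows "loaded M'"
  using assms by (simp add: loaded_def)

lemma length_L_pos: "i < n \<Longrightarrow> 0 < length (L i)"
  using set_L[of i] R_refl[of i] by (auto simp: length_pos_if_in_set)

lemma visited_start: "visited M b (M 2 b) = {}"
  by (simp add: visited_def)

lemma visited_end: "loaded M \<Longrightarrow> b < n \<Longrightarrow> visited M b (M 3 b) = {y. R b y}"
  by (simp add: visited_def loaded_def set_L)

lemma visited_Suc:
  assumes "loaded M" "b < n" "M 2 b \<le> j" "j < M 3 b"
  shows "visited M b (Suc j) = insert (M 4 j) (visited M b j)" "M 4 j \<notin> visited M b j"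
    "R b (M 4 j)"
proof -
  define k where "k = j - M 2 b"
  have k: "j = M 2 b + k" "k < length (L b)" using assms by (auto simp: loaded_def k_def)
  have M: "M 4 j = L b ! k" using assms k by (auto simp: loaded_def)
  have "take (Suc k) (L b) = take k (L b) @ [L b ! k]"
    using k by (simp add: take_Suc_conv_app_nth)
  moreover have "distinct (take (Suc k) (L b))" using distinct_L assms by simp
  ultimately show "visited M b (Suc j) = insert (M 4 j) (visited M b j)" "M 4 j \<notin> visited M b j"
    using k M by (auto simp: visited_def)
  show "R b (M 4 j)" using M k set_L[OF assms(2)] nth_mem[of k "L b"] by auto
qed

text \<open>
  \<open>f\<close> and \<open>g\<close> are the arrays 8 and 9.
\<close>

definition marks :: "nat set \<Rightarrow> (nat \<Rightarrow> nat) \<Rightarrow> (nat \<Rightarrow> nat) \<Rightarrow> bool" where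
  "marks D f g \<longleftrightarrow>
     (\<forall>y<n. if f y = 0 then \<not> dominated D y else f y - 1 \<in> D \<and> R y (f y - 1)) \<and>
     (\<forall>d<n. 0 < g (Suc d) \<longleftrightarrow> d \<in> D \<and> near D d)"

lemma marks_start: "marks {} (\<lambda>_. 0) (\<lambda>_. 0)"
  by (simp add: marks_def dominated_def)

text \<open>The recorded dominators of the closed neighbours of \<open>b\<close> are the only old
  vertices that have to be marked: any other dominator of such a neighbour shares it with the
  recorded one and was near already.\<close>

lemma marks_insert:
  assumes m: "marks D f g" and b: "b < n" "b \<notin> D" and D: "D \<subseteq> {..<n}"
    and f': "\<And>y. f' y = (if R b y \<and> f y = 0 then Suc b else f y)"
    and g': "\<And>d. 0 < g' (Suc d) \<longleftrightarrow>
       0 < g (Suc d) \<or> (\<exists>y. R b y \<and> 0 < f y \<and> (d = b \<or> f y = Suc d))"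
  shows "marks (insert b D) f' g'"
  unfolding marks_def
proof (intro conjI allI impI)
  have f: "f y \<noteq> 0 \<Longrightarrow> f y - 1 \<in> D \<and> R y (f y - 1)" "f y = 0 \<Longrightarrow> \<not> dominated D y" if "y < n" for y
    using m that by (auto simp: marks_def split: if_splits)
  fix y assume "y < n"
  then show "if f' y = 0 then \<not> dominated (insert b D) y else f' y - 1 \<in> insert b D \<and> R y (f' y - 1)"
    using f[of y] R_sym by (auto simp: f' dominated_def)
next
  have f: "f y \<noteq> 0 \<Longrightarrow> f y - 1 \<in> D \<and> R y (f y - 1)" "f y = 0 \<Longrightarrow> \<not> dominated D y" if "y < n" for y
    using m that by (auto simp: marks_def split: if_splits)
  have g: "0 < g (Suc d) \<longleftrightarrow> d \<in> D \<and> near D d" if "d < n" for d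
    using m that by (auto simp: marks_def)
  fix d assume d: "d < n"
  show "0 < g' (Suc d) \<longleftrightarrow> d \<in> insert b D \<and> near (insert b D) d"
  proof
    assume "0 < g' (Suc d)"
    then have "0 < g (Suc d) \<or> (\<exists>y. R b y \<and> 0 < f y \<and> (d = b \<or> f y = Suc d))"
      unfolding g' .
    then show "d \<in> insert b D \<and> near (insert b D) d"
    proof (elim disjE exE conjE)
      assume "0 < g (Suc d)"
      then show ?thesis using g[OF d] near_mono[of D d "insert b D"] by blast
    next
      fix y assume y: "R b y" "0 < f y" "d = b"
      then have "f y - 1 \<in> D" "R y (f y - 1)" using f(1)[of y] R_less2 by auto
      moreover have "f y - 1 \<noteq> d" using calculation y b by auto
      ultimately show ?thesis using y unfolding near_def by auto
    next
      fix y assume y: "R b y" "f y = Suc d"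
      then have "d \<in> D" "R y d" using f(1)[of y] R_less2 by auto
      moreover have "b \<noteq> d" using calculation b by auto
      ultimately show ?thesis using y R_sym unfolding near_def by auto
    qed
  next
    assume as: "d \<in> insert b D \<and> near (insert b D) d"
    then obtain d' y where d': "d' \<in> insert b D" "d' \<noteq> d" "R d y" "R y d'"
      by (auto simp: near_def)
    have y: "y < n" using d' R_less2 by blast
    show "0 < g' (Suc d)"
    proof (cases "d = b")
      case True
      then have "f y \<noteq> 0" using f(2)[OF y] d' by (auto simp: dominated_def)
      with True d' show ?thesis unfolding g' by blast
    next
      case False
      then have dD: "d \<in> D" using as by simp
      then have fy: "f y \<noteq> 0" using f(2)[OF y] d' R_sym by (auto simp: dominated_def)
      show ?thesis
      proof (cases "d' = b \<and> f y = Suc d")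
        case True
        then have "R b y" "0 < f y" using d' R_sym by auto
        then show ?thesis unfolding g' using True by blast
      next
        case no: False
        have "near D d"
        proof (cases "d' = b")
          case True
          then have "f y - 1 \<noteq> d" using no fy by auto
          then show ?thesis using f(1)[OF y fy] d' unfolding near_def by blast
        next
          case False
          then show ?thesis using d' unfolding near_def by blast
        qed
        then show ?thesis unfolding g' using g[OF d] dD by blast
      qed
    qed
  qed
qed

text \<open>The arbitrary postcondition \<open>Q\<close> lets such specifications be chained under
  \<open>wp\<close>. The cost is charged to the list of \<open>b\<close>; since that list is
  nonempty, it also absorbs the constant overhead.\<close>

lemma wp_insert_chosen:
  assumes s: "sc s 2 = 1" "sc s 3 = 0" "sc s 12 = b" "loaded (ar s)" "b < n"
    and m: "marks D (ar s 8) (ar s 9)" "b \<notin> D" "D \<subseteq> {..<n}"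
    and Q: "\<And>s'. sc s' 2 = 1 \<Longrightarrow> sc s' 3 = 0 \<Longrightarrow> sc s' 4 = sc s 4 \<Longrightarrow> sc s' 5 = sc s 5 \<Longrightarrow>
       (\<And>k. k \<notin> {8, 9} \<Longrightarrow> ar s' k = ar s k) \<Longrightarrow> marks (insert b D) (ar s' 8) (ar s' 9) \<Longrightarrow>
       rout s' = rout s @ [\<alpha> ! b] \<Longrightarrow> tm s' \<le> tm s + 100 * length (L b) \<Longrightarrow> Q s'"
  shows "wp insert_chosen Q s"
proof -
  let ?V = "visited (ar s) b"
  define I :: "nat \<Rightarrow> state \<Rightarrow> bool" where "I = (\<lambda>j s'. sc s' 3 = 0 \<and> sc s' 4 = sc s 4 \<and> sc s' 5 = sc s 5 \<and> sc s' 14 = Suc b \<and>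
    (\<forall>k. k \<notin> {8, 9} \<longrightarrow> ar s' k = ar s k) \<and>
    (\<forall>y. ar s' 8 y = (if y \<in> ?V j \<and> ar s 8 y = 0 then Suc b else ar s 8 y)) \<and>
    (\<forall>d. 0 < ar s' 9 (Suc d) \<longleftrightarrow>
       0 < ar s 9 (Suc d) \<or> (\<exists>y\<in>?V j. 0 < ar s 8 y \<and> (d = b \<or> ar s 8 y = Suc d))) \<and>
    rout s' = rout s @ [\<alpha> ! b] \<and> tm s' \<le> tm s + 30 + 40 * (j - ar s 2 b))"
  have len: "ar s 3 b = ar s 2 b + length (L b)" "ar s 0 b = \<alpha> ! b"
    using s by (auto simp: loaded_def)
  have "wp (For 6 7 8 (Get 11 4 6 ;; Get 15 8 11 ;; Cond 15 (Put 9 14 2 ;; Put 9 15 2) (Put 8 11 14))) Q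
    (s\<lparr>rout := rout s @ [\<alpha> ! b],
       sc := (sc s)(15 := \<alpha> ! b, 14 := Suc b, 6 := ar s 2 b, 7 := ar s 3 b), tm := tm s + 23\<rparr>)"
  proof (rule wp_For[where I = I and a = "ar s 2 b" and b = "ar s 3 b"], goal_cases)
    case 10
    show ?case using s by (simp add: I_def visited_start)
  next
    case (11 j s')
    note vis = visited_Suc[OF s(4,5) 11(5,6)]
    have M: "ar s' 4 = ar s 4" using 11(1) by (simp add: I_def)
    have f: "ar s' 8 (ar s 4 j) = ar s 8 (ar s 4 j)" using 11(1) vis by (simp add: I_def)
    show ?case
      using 11 vis(1,2) unfolding I_def by (auto simp: M f Suc_diff_le)
  next
    case (12 s')
    have "marks (insert b D) (ar s' 8) (ar s' 9)"
      by (rule marks_insert[OF m(1) s(5) m(2,3)])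
        (use 12 visited_end[OF s(4,5)] in \<open>auto simp: I_def\<close>)
    moreover have "tm s' \<le> tm s + 30 + 40 * length (L b)"
      using 12 len by (simp add: I_def)
    then have "tm s' + 3 \<le> tm s + 100 * length (L b)"
      using length_L_pos[OF s(5)] by linarith
    ultimately show ?case using 12 by (intro Q) (auto simp: I_def)
  qed (use s len in auto)
  then show ?thesis using s len by (simp add: insert_chosen_def add_ac)
qed

definition keys :: "nat \<Rightarrow> (nat \<Rightarrow> nat \<Rightarrow> nat) \<Rightarrow> bool" where
  "keys i M \<longleftrightarrow> (\<forall>x<n. M 6 x = key i x \<and> M 7 x = (if \<exists>z<i. R x z then 2 else 1))"

text \<open>When \<open>i\<close> has been scanned, each closed neighbour of \<open>i\<close> loses
  2 for the count. At the first such loss it also gains the bonus for having an earlier neighbour,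
  so the net decrease is 1 once and 2 from then on.\<close>

lemma key_Suc:
  "key (Suc i) x = (if R i x then key i x - (if \<exists>z<i. R x z then 2 else 1) else key i x)"
proof (cases "R i x")
  case True
  then have "{z. i \<le> z \<and> R x z} = insert i {z. Suc i \<le> z \<and> R x z}"
    using R_sym by (auto simp: le_Suc_eq not_less_eq_eq)
  then have "card {z. i \<le> z \<and> R x z} = Suc (card {z. Suc i \<le> z \<and> R x z})"
    using finite_R_from[of "Suc i" x] by simp
  moreover have "\<exists>z<Suc i. R x z" using True R_sym by blast
  ultimately show ?thesis using True by (simp add: key_def)
next
  case False
  then have "{z. i \<le> z \<and> R x z} = {z. Suc i \<le> z \<and> R x z}"
    using R_sym Suc_le_eq le_eq_less_or_eq by auto
  moreover have "(\<exists>z<Suc i. R x z) \<longleftrightarrow> (\<exists>z<i. R x z)"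
    using False R_sym less_Suc_eq by blast
  ultimately show ?thesis using False by (simp add: key_def)
qed

text \<open>This ensures that the search for the maximum, which starts at 0, replaces its dummy
  candidate.\<close>

lemma key_pos:
  assumes "i < n"
  shows "0 < key i i"
proof -
  have "i \<in> {z. i \<le> z \<and> R i z}" using assms R_refl by simp
  then have "0 < card {z. i \<le> z \<and> R i z}"
    using card_gt_0_iff finite_R_from by blast
  then show ?thesis by (simp add: key_def)
qed

lemma wp_choose_best:
  assumes s: "sc s 2 = 1" "sc s 3 = 0" "sc s 5 = i" "loaded (ar s)" "i < n" "keys i (ar s)"
    and Q: "\<And>s' b. sc s' 2 = 1 \<Longrightarrow> sc s' 3 = 0 \<Longrightarrow> sc s' 4 = sc s 4 \<Longrightarrow> sc s' 5 = i \<Longrightarrow>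
       ar s' = ar s \<Longrightarrow> rout s' = rout s \<Longrightarrow> sc s' 12 = b \<Longrightarrow> greedy i b \<Longrightarrow>
       tm s' \<le> tm s + 100 * length (L i) \<Longrightarrow> Q s'"
  shows "wp choose_best Q s"
proof -
  let ?V = "visited (ar s) i"
  define I :: "nat \<Rightarrow> state \<Rightarrow> bool" where "I = (\<lambda>j s'. sc s' 3 = 0 \<and> sc s' 4 = sc s 4 \<and> sc s' 5 = i \<and>
    ar s' = ar s \<and> rout s' = rout s \<and> (\<forall>x\<in>?V j. ar s 6 x \<le> sc s' 13) \<and>
    (0 < sc s' 13 \<longrightarrow> sc s' 12 \<in> ?V j \<and> ar s 6 (sc s' 12) = sc s' 13) \<and>
    tm s' \<le> tm s + 20 + 40 * (j - ar s 2 i))"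
  have len: "ar s 3 i = ar s 2 i + length (L i)" using s by (auto simp: loaded_def)
  have "wp (For 6 7 8 (Get 10 4 6 ;; Get 15 6 10 ;; Minus 18 15 13 ;;
        Cond 18 (Plus 12 10 3 ;; Plus 13 15 3) (Lit 18 0))) Q
    (s\<lparr>sc := (sc s)(12 := 0, 13 := 0, 6 := ar s 2 i, 7 := ar s 3 i), tm := tm s + 16\<rparr>)"
  proof (rule wp_For[where I = I and a = "ar s 2 i" and b = "ar s 3 i"], goal_cases)
    case 10
    show ?case using s by (simp add: I_def visited_start)
  next
    case (11 j s')
    note vis = visited_Suc[OF s(4,5) 11(5,6)]
    show ?case
      using 11 vis(1) unfolding I_def by (auto simp: Suc_diff_le)
  next
    case (12 s')
    then have J: "I (ar s 3 i) s'" by simp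
    note V = visited_end[OF s(4,5)]
    have k: "ar s 6 x = key i x" if "R i x" for x
      using s(6) R_less2[OF that] by (simp add: keys_def)
    have max: "key i x \<le> sc s' 13" if "R i x" for x
      using J that V k[OF that] unfolding I_def by (metis mem_Collect_eq)
    then have "0 < sc s' 13" using key_pos[OF s(5)] R_refl[OF s(5)] by force
    then have "R i (sc s' 12)" "key i (sc s' 12) = sc s' 13"
      using J V k unfolding I_def by auto
    then have "greedy i (sc s' 12)" using max by (simp add: greedy_def)
    moreover have "tm s' \<le> tm s + 20 + 40 * length (L i)" using 12 len by (simp add: I_def)
    then have "tm s' + 3 \<le> tm s + 100 * length (L i)"
      using length_L_pos[OF s(5)] by linarith
    ultimately show ?case using 12 s by (intro Q) (auto simp: I_def)
  qed (use s len in auto)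
  then show ?thesis using s len by (simp add: choose_best_def add_ac)
qed

lemma wp_update_keys:
  assumes s: "sc s 2 = 1" "sc s 3 = 0" "sc s 5 = i" "loaded (ar s)" "i < n" "keys i (ar s)"
    and Q: "\<And>s'. sc s' 2 = 1 \<Longrightarrow> sc s' 3 = 0 \<Longrightarrow> sc s' 4 = sc s 4 \<Longrightarrow> sc s' 5 = i \<Longrightarrow>
       (\<And>k. k \<notin> {6, 7} \<Longrightarrow> ar s' k = ar s k) \<Longrightarrow> keys (Suc i) (ar s') \<Longrightarrow> rout s' = rout s \<Longrightarrow>
       tm s' \<le> tm s + 100 * length (L i) \<Longrightarrow> Q s'"
  shows "wp update_keys Q s"
proof -
  let ?V = "visited (ar s) i"
  define I :: "nat \<Rightarrow> state \<Rightarrow> bool" where "I = (\<lambda>j s'. sc s' 3 = 0 \<and> sc s' 4 = sc s 4 \<and> sc s' 5 = i \<and>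
    (\<forall>k. k \<notin> {6, 7} \<longrightarrow> ar s' k = ar s k) \<and> rout s' = rout s \<and>
    (\<forall>x. ar s' 6 x = (if x \<in> ?V j then ar s 6 x - ar s 7 x else ar s 6 x)) \<and>
    (\<forall>x. ar s' 7 x = (if x \<in> ?V j then 2 else ar s 7 x)) \<and>
    tm s' \<le> tm s + 20 + 50 * (j - ar s 2 i))"
  have len: "ar s 3 i = ar s 2 i + length (L i)" using s by (auto simp: loaded_def)
  have "wp (For 6 7 8 (Get 10 4 6 ;; Get 15 6 10 ;; Get 18 7 10 ;; Minus 15 15 18 ;; Put 6 10 15 ;;
        Lit 18 2 ;; Put 7 10 18)) Q
    (s\<lparr>sc := (sc s)(6 := ar s 2 i, 7 := ar s 3 i), tm := tm s + 14\<rparr>)"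
  proof (rule wp_For[where I = I and a = "ar s 2 i" and b = "ar s 3 i"], goal_cases)
    case 10
    show ?case using s by (simp add: I_def visited_start)
  next
    case (11 j s')
    note vis = visited_Suc[OF s(4,5) 11(5,6)]
    have M: "ar s' 4 = ar s 4" using 11(1) by (simp add: I_def)
    show ?case
      using 11 vis(1,2) unfolding I_def by (auto simp: M Suc_diff_le)
  next
    case (12 s')
    then have J: "I (ar s 3 i) s'" by simp
    have "keys (Suc i) (ar s')"
      unfolding keys_def
    proof (intro allI impI)
      fix x assume x: "x < n"
      have lt: "(\<exists>z<Suc i. R x z) \<longleftrightarrow> R i x \<or> (\<exists>z<i. R x z)"
        using R_sym less_Suc_eq by blast
      have "ar s 6 x = key i x" "ar s 7 x = (if \<exists>z<i. R x z then 2 else 1)"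
        using s(6) x by (auto simp: keys_def)
      moreover have "ar s' 6 x = (if R i x then ar s 6 x - ar s 7 x else ar s 6 x)"
        "ar s' 7 x = (if R i x then 2 else ar s 7 x)"
        using J visited_end[OF s(4,5)] unfolding I_def by auto
      ultimately show "ar s' 6 x = key (Suc i) x \<and> ar s' 7 x = (if \<exists>z<Suc i. R x z then 2 else 1)"
        unfolding lt key_Suc[of i x] by (cases "R i x"; cases "\<exists>z<i. R x z") auto
    qed
    moreover have "tm s' \<le> tm s + 20 + 50 * length (L i)" using 12 len by (simp add: I_def)
    then have "tm s' + 3 \<le> tm s + 100 * length (L i)"
      using length_L_pos[OF s(5)] by linarith
    ultimately show ?case using 12 s by (intro Q) (auto simp: I_def)
  qed (use s len in auto)
  then show ?thesis using s len by (simp add: update_keys_def add_ac)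
qed

text \<open>The three indices advance one at a time within a pass: domination, partners, keys.
  Insertions have their own time account, charged to the chosen vertices, since the cost of one
  insertion is not bounded by the degree of the scanned vertex.\<close>

definition progress :: "nat \<Rightarrow> nat \<Rightarrow> nat \<Rightarrow> nat \<Rightarrow> state \<Rightarrow> bool" where
  "progress i j k c s \<longleftrightarrow> sc s 2 = 1 \<and> sc s 3 = 0 \<and> loaded (ar s) \<and> keys k (ar s) \<and>
     (\<exists>V U W ds. greedy_inv i j (set ds) V U W \<and> marks (set ds) (ar s 8) (ar s 9) \<and>
        distinct ds \<and> rout s = map ((!) \<alpha>) ds \<and> tm s \<le> c + 100 * (\<Sum>d\<leftarrow>ds. length (L d)))"

lemma progress_cong:
  assumes "progress i j k c s" "sc s' 2 = sc s 2" "sc s' 3 = sc s 3" "ar s' = ar s" "rout s' = rout s"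
    and "tm s' \<le> tm s + m" "c + m \<le> c'"
  shows "progress i j k c' s'"
  using assms(1) unfolding progress_def
  by (elim exE conjE) (use assms(2-) in \<open>fastforce\<close>)

lemma wp_insert_progress:
  assumes s: "sc s 2 = 1" "sc s 3 = 0" "sc s 12 = b" "loaded (ar s)" "keys k (ar s)"
    and g: "greedy_inv i j (insert b (set ds)) V U W" "b \<notin> set ds"
    and m: "marks (set ds) (ar s 8) (ar s 9)" "distinct ds" "rout s = map ((!) \<alpha>) ds"
       "tm s \<le> c + 100 * (\<Sum>d\<leftarrow>ds. length (L d))"
    and Q: "\<And>s'. progress i j k c s' \<Longrightarrow> sc s' 4 = sc s 4 \<Longrightarrow> sc s' 5 = sc s 5 \<Longrightarrow> Q s'"
  shows "wp insert_chosen Q s"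
proof (rule wp_insert_chosen[OF s(1-4) _ m(1) g(2)])
  show "b < n" "set ds \<subseteq> {..<n}" using greedy_invD(1)[OF g(1)] by auto
  fix s' :: state
  assume s': "sc s' 2 = 1" "sc s' 3 = 0" "sc s' 4 = sc s 4" "sc s' 5 = sc s 5"
      "\<And>k. k \<notin> {8, 9} \<Longrightarrow> ar s' k = ar s k" "marks (insert b (set ds)) (ar s' 8) (ar s' 9)"
      "rout s' = rout s @ [\<alpha> ! b]" "tm s' \<le> tm s + 100 * length (L b)"
  have "loaded (ar s')" by (rule loaded_cong[OF s(4)]) (use s'(5) in auto)
  moreover have "keys k (ar s')" using s(5) s'(5) by (simp add: keys_def)
  ultimately have "progress i j k c s'"
    unfolding progress_def using s' g m
    by (intro conjI exI[of _ V] exI[of _ U] exI[of _ W] exI[of _ "ds @ [b]"]) auto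
  then show "Q s'" using Q s' by blast
qed

lemma wp_dominate:
  assumes p: "progress i i i c s" and i: "sc s 5 = i" "i < n"
    and Q: "\<And>s'. progress (Suc i) i i (c + 150 * length (L i)) s' \<Longrightarrow> sc s' 4 = sc s 4 \<Longrightarrow>
       sc s' 5 = i \<Longrightarrow> Q s'"
  shows "wp dominate Q s"
proof -
  obtain V U W ds where s: "sc s 2 = 1" "sc s 3 = 0" "loaded (ar s)" "keys i (ar s)"
    and g: "greedy_inv i i (set ds) V U W" and m: "marks (set ds) (ar s 8) (ar s 9)"
    and ds: "distinct ds" "rout s = map ((!) \<alpha>) ds" "tm s \<le> c + 100 * (\<Sum>d\<leftarrow>ds. length (L d))"
    using p unfolding progress_def by blast
  have len: "1 \<le> length (L i)" using length_L_pos[OF i(2)] by (simp only: One_nat_def Suc_le_eq)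
  let ?s = "s\<lparr>sc := (sc s)(14 := ar s 8 i), tm := tm s + 10\<rparr>"
  show ?thesis
  proof (cases "0 < ar s 8 i")
    case True
    then have "dominated (set ds) i"
      using m i by (auto simp: marks_def dominated_def split: if_splits)
    from greedy_inv_dominated[OF g this]
    have "progress (Suc i) i i (c + 11) (?s\<lparr>sc := (sc ?s)(18 := 0), tm := tm s + 11\<rparr>)"
      unfolding progress_def using s m ds
      by (intro conjI exI[of _ V] exI[of _ U] exI[of _ W] exI[of _ ds]) auto
    then have "progress (Suc i) i i (c + 150 * length (L i)) (?s\<lparr>sc := (sc ?s)(18 := 0), tm := tm s + 11\<rparr>)"
      by (rule progress_cong[where m = 0]) (use len in auto)
    then show ?thesis using True i Q by (simp add: dominate_def add_ac)
  next
    case False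
    then have nd: "\<not> dominated (set ds) i" using m i by (auto simp: marks_def)
    have "wp choose_best (wp insert_chosen Q) ?s"
    proof (rule wp_choose_best)
      fix s' :: state and b
      assume s': "sc s' 2 = 1" "sc s' 3 = 0" "sc s' 4 = sc ?s 4" "sc s' 5 = i" "ar s' = ar ?s"
         "rout s' = rout ?s" "sc s' 12 = b" "greedy i b" "tm s' \<le> tm ?s + 100 * length (L i)"
      note new = greedy_inv_choose[OF g i(2) nd s'(8)]
      show "wp insert_chosen Q s'"
        by (rule wp_insert_progress[OF s'(1,2,7) _ _ new(2,1),
              where c = "c + 150 * length (L i)" and k = i])
          (use s s' m ds len i Q in auto)
    qed (use s i in auto)
    then show ?thesis using False i by (simp add: dominate_def add_ac)
  qed
qed

lemma wp_give_partner:
  assumes p: "progress (Suc i) i i c s" and i: "sc s 5 = i" "i < n"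
    and Q: "\<And>s'. progress (Suc i) (Suc i) i (c + 100) s' \<Longrightarrow> sc s' 4 = sc s 4 \<Longrightarrow>
       sc s' 5 = i \<Longrightarrow> Q s'"
  shows "wp give_partner Q s"
proof -
  obtain V U W ds where s: "sc s 2 = 1" "sc s 3 = 0" "loaded (ar s)" "keys i (ar s)"
    and g: "greedy_inv (Suc i) i (set ds) V U W" and m: "marks (set ds) (ar s 8) (ar s 9)"
    and ds: "distinct ds" "rout s = map ((!) \<alpha>) ds" "tm s \<le> c + 100 * (\<Sum>d\<leftarrow>ds. length (L d))"
    using p unfolding progress_def by blast
  define u where "u = ar s 8 i - 1"
  have "dominated (set ds) i" using greedy_invD(5)[OF g, of i] by simp
  then have u: "u \<in> set ds" "R i u" "ar s 8 i = Suc u"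
    using m i by (auto simp: marks_def u_def split: if_splits)
  have un: "u < n" using u R_less2 by blast
  have sat: "0 < ar s 9 (Suc u) \<longleftrightarrow> near (set ds) u" using m u un by (auto simp: marks_def)
  have tops: "ar s 5 u = top u" "ar s 5 i = top i" using s(3) un i by (auto simp: loaded_def)
  have ge: "i \<le> top u" "u \<le> top i" using u(2) R_le_top R_sym by blast+
  \<comment> \<open>Such a \<open>d\<close> shares \<open>i\<close> with the recorded dominator
    \<open>u\<close>. Hence only \<open>u\<close> can still lack a partner at \<open>i\<close>, and
    inspecting it alone is enough.\<close>
  have other: "near (set ds) d" if "d \<in> set ds" "top d = i" "d \<noteq> u" for d
  proof -
    have "d < n" using that(1) greedy_invD(1)[OF g] by auto
    then have "R d i" using R_top that by blast
    then show ?thesis using u(1,2) that(3) unfolding near_def by auto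
  qed
  have skip: "Q s'" if "near (set ds) u \<or> top u \<noteq> i" "sc s' 2 = sc s 2" "sc s' 3 = sc s 3"
      "sc s' 4 = sc s 4" "sc s' 5 = sc s 5" "ar s' = ar s" "rout s' = rout s" "tm s' \<le> tm s + 100" for s' :: state
  proof -
    have "greedy_inv (Suc i) (Suc i) (set ds) V U W"
      by (rule greedy_inv_no_partner[OF g]) (use other that in metis)
    then have "progress (Suc i) (Suc i) i (c + 100) s'"
      unfolding progress_def using s m ds that
      by (intro conjI exI[of _ V] exI[of _ U] exI[of _ W] exI[of _ ds]) auto
    then show ?thesis using Q that i by simp
  qed
  show ?thesis
  proof (cases "near (set ds) u \<or> top u \<noteq> i")
    case True
    then show ?thesis
      using i u sat tops ge s by (auto simp: give_partner_def intro!: skip)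
  next
    case False
    then have far: "\<not> near (set ds) u" "top u = i" by auto
    have ins: "wp insert_chosen Q s'" if
      b: "sc s' 12 = b" "if top i = u then R u b \<and> b \<noteq> u else b = top i" and
      s': "sc s' 2 = sc s 2" "sc s' 3 = sc s 3"
      "sc s' 4 = sc s 4" "sc s' 5 = sc s 5" "ar s' = ar s" "rout s' = rout s" "tm s' \<le> tm s + 100" for s' :: state and b
    proof -
      note new = greedy_inv_partner[OF g u(1) far(2,1) b(2)]
      then obtain W' where W': "greedy_inv (Suc i) (Suc i) (insert b (set ds)) V U W'" by blast
      show ?thesis
        by (rule wp_insert_progress[OF _ _ b(1) _ _ W' new(1), where c = "c + 100" and k = i])
          (use s s' m ds i Q in auto)
    qed
    have "ar s 4 (ar s 2 u + 0) = L u ! 0"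
      using s(3) un length_L_pos[OF un] unfolding loaded_def by blast
    then have hd: "ar s 4 (ar s 2 u) = L u ! 0" "L u ! 0 \<noteq> u" "R u (L u ! 0)"
      using length_L_pos[OF un] hd_L[OF un] set_L[OF un] nth_mem[of 0 "L u"] by auto
    show ?thesis
    proof (cases "top i = u")
      case True
      then show ?thesis
        using i u sat tops far s hd by (auto simp: give_partner_def intro!: ins)
    next
      case F: False
      then have "u < top i" using ge by simp
      then show ?thesis
        using F i u sat tops far s by (auto simp: give_partner_def intro!: ins)
    qed
  qed
qed

lemma wp_scan:
  assumes s: "sc s 2 = 1" "sc s 3 = 0" "sc s 4 = n" "loaded (ar s)" "keys 0 (ar s)"
      "ar s 8 = (\<lambda>_. 0)" "ar s 9 = (\<lambda>_. 0)" "rout s = []"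
    and Q: "\<And>s' ds. distinct ds \<Longrightarrow> rout s' = map ((!) \<alpha>) ds \<Longrightarrow> semitotal (set ds) \<Longrightarrow>
       (\<And>D. semitotal D \<Longrightarrow> card (set ds) \<le> card D) \<Longrightarrow>
       tm s' \<le> tm s + 10 + 600 * (\<Sum>i<n. length (L i)) \<Longrightarrow> Q s'"
  shows "wp scan Q s"
proof -
  define I :: "nat \<Rightarrow> state \<Rightarrow> bool" where
    "I = (\<lambda>j s'. progress j j j (tm s + 2 + 500 * (\<Sum>i<j. length (L i))) s' \<and> sc s' 4 = n)"
  have "wp (For 5 4 9 (dominate ;; give_partner ;; update_keys)) Q
      (s\<lparr>sc := (sc s)(5 := 0), tm := tm s + 1\<rparr>)"
  proof (rule wp_For[where I = I and a = 0 and b = n], goal_cases)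
    case 10
    show ?case
      unfolding I_def progress_def
      using s greedy_inv_start[of "\<lambda>_. 0"] marks_start
      by (intro conjI exI[of _ "{}"] exI[of _ "\<lambda>_. 0"] exI[of _ "[]"]) auto
  next
    case (11 j s')
    let ?c = "tm s + 2 + 500 * (\<Sum>i<j. length (L i))"
    have len: "1 \<le> length (L j)" using length_L_pos[OF 11(6)] by (simp only: One_nat_def Suc_le_eq)
    have p: "progress j j j (?c + 3) (tick 3 s')"
      by (rule progress_cong[where s = s' and c = ?c and m = 3]) (use 11(1) in \<open>auto simp: I_def\<close>)
    have "wp dominate (wp give_partner (wp update_keys (\<lambda>s'. sc s' 5 = j \<and> sc s' 4 = n \<and> sc s' 2 = 1 \<and>
         I (Suc j) (s'\<lparr>sc := (sc s')(5 := Suc j, 9 := n - Suc j), tm := tm s' + 2\<rparr>)))) (tick 3 s')"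
    proof (rule wp_dominate[OF p])
      fix s1 :: state assume s1: "progress (Suc j) j j (?c + 3 + 150 * length (L j)) s1"
          "sc s1 4 = sc (tick 3 s') 4" "sc s1 5 = j"
      show "wp give_partner (wp update_keys (\<lambda>s'. sc s' 5 = j \<and> sc s' 4 = n \<and> sc s' 2 = 1 \<and>
         I (Suc j) (s'\<lparr>sc := (sc s')(5 := Suc j, 9 := n - Suc j), tm := tm s' + 2\<rparr>))) s1"
      proof (rule wp_give_partner[OF s1(1,3) 11(6)])
        fix s2 :: state assume s2: "progress (Suc j) (Suc j) j (?c + 3 + 150 * length (L j) + 100) s2"
            "sc s2 4 = sc s1 4" "sc s2 5 = j"
        obtain V U W ds where s: "sc s2 2 = 1" "sc s2 3 = 0" "loaded (ar s2)" "keys j (ar s2)"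
          and g: "greedy_inv (Suc j) (Suc j) (set ds) V U W" "marks (set ds) (ar s2 8) (ar s2 9)"
             "distinct ds" "rout s2 = map ((!) \<alpha>) ds"
             "tm s2 \<le> ?c + 3 + 150 * length (L j) + 100 + 100 * (\<Sum>d\<leftarrow>ds. length (L d))"
          using s2(1) unfolding progress_def by blast
        show "wp update_keys (\<lambda>s'. sc s' 5 = j \<and> sc s' 4 = n \<and> sc s' 2 = 1 \<and>
         I (Suc j) (s'\<lparr>sc := (sc s')(5 := Suc j, 9 := n - Suc j), tm := tm s' + 2\<rparr>)) s2"
        proof (rule wp_update_keys[OF s(1,2) s2(3) s(3) 11(6) s(4)])
          fix s3 :: state assume s3: "sc s3 2 = 1" "sc s3 3 = 0" "sc s3 4 = sc s2 4" "sc s3 5 = j"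
            "\<And>k. k \<notin> {6, 7} \<Longrightarrow> ar s3 k = ar s2 k" "keys (Suc j) (ar s3)" "rout s3 = rout s2"
            "tm s3 \<le> tm s2 + 100 * length (L j)"
          have "loaded (ar s3)" by (rule loaded_cong[OF s(3)]) (use s3(5) in auto)
          moreover have "tm s3 + 2 \<le> tm s + 2 + 500 * (\<Sum>i<Suc j. length (L i))
              + 100 * (\<Sum>d\<leftarrow>ds. length (L d))"
            using s3(8) g(5) len by (simp add: algebra_simps)
          ultimately have "I (Suc j) (s3\<lparr>sc := (sc s3)(5 := Suc j, 9 := n - Suc j), tm := tm s3 + 2\<rparr>)"
            unfolding I_def progress_def using s3 g 11(1) s2(2) s1(2)
            by (intro conjI exI[of _ V] exI[of _ U] exI[of _ W] exI[of _ ds]) (auto simp: I_def)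
          then show "sc s3 5 = j \<and> sc s3 4 = n \<and> sc s3 2 = 1 \<and>
              I (Suc j) (s3\<lparr>sc := (sc s3)(5 := Suc j, 9 := n - Suc j), tm := tm s3 + 2\<rparr>)"
            using s3 s2(2) s1(2) 11 by (simp add: I_def)
        qed
      qed
    qed (use 11 in auto)
    then show ?case by (simp only: wp_Seq)
  next
    case (12 s')
    then obtain V U W ds where g: "greedy_inv n n (set ds) V U W" "distinct ds"
        "rout s' = map ((!) \<alpha>) ds"
        "tm s' \<le> tm s + 2 + 500 * (\<Sum>i<n. length (L i)) + 100 * (\<Sum>d\<leftarrow>ds. length (L d))"
      unfolding I_def progress_def by blast
    \<comment> \<open>No vertex is chosen twice, so all insertions together cost at most the total
      length of the lists.\<close>
    have "(\<Sum>d\<leftarrow>ds. length (L d)) = (\<Sum>d\<in>set ds. length (L d))"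
      using g(2) by (simp add: sum_list_distinct_conv_sum_set)
    also have "\<dots> \<le> (\<Sum>i<n. length (L i))"
      using greedy_invD(1)[OF g(1)] by (intro sum_mono2) auto
    finally have "tm s' + 3 \<le> tm s + 10 + 600 * (\<Sum>i<n. length (L i))"
      using g(4) by linarith
    then show ?case
      using g greedy_inv_semitotal[OF g(1)] greedy_inv_minimum[OF g(1)] by (intro Q[of ds]) auto
  qed (use s in auto)
  then show ?thesis using s by (simp add: scan_def)
qed

end

section \<open>Reading the input\<close>

locale greedy_input = greedy_ram +
  fixes A :: "nat list list" and pos :: "nat \<Rightarrow> nat"
  assumes length_A: "length A = n" and length_\<alpha>: "length \<alpha> = n"
    and \<alpha>_less: "i < n \<Longrightarrow> \<alpha> ! i < n" and pos_\<alpha>: "i < n \<Longrightarrow> pos (\<alpha> ! i) = i"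
    and pos_less: "v < n \<Longrightarrow> pos v < n" and \<alpha>_pos: "v < n \<Longrightarrow> \<alpha> ! pos v = v"
    and A_less: "v < n \<Longrightarrow> set (A ! v) \<subseteq> {..<n}"
    and L_eq: "i < n \<Longrightarrow> L i = map pos (A ! (\<alpha> ! i)) @ [i]"
begin

lemma \<alpha>_inj: "i < n \<Longrightarrow> j < n \<Longrightarrow> \<alpha> ! i = \<alpha> ! j \<longleftrightarrow> i = j"
  using pos_\<alpha> by metis

lemma pos_inj: "v < n \<Longrightarrow> w < n \<Longrightarrow> pos v = pos w \<longleftrightarrow> v = w"
  using \<alpha>_pos by metis

lemma wp_read_order:
  assumes Q: "\<And>s. sc s 2 = 1 \<Longrightarrow> sc s 3 = 0 \<Longrightarrow> sc s 4 = n \<Longrightarrow> rin s = xs \<Longrightarrow>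
      (\<And>i. i < n \<Longrightarrow> ar s 0 i = \<alpha> ! i) \<Longrightarrow> (\<And>v. v < n \<Longrightarrow> ar s 1 v = pos v) \<Longrightarrow>
      ar s 8 = (\<lambda>_. 0) \<Longrightarrow> ar s 9 = (\<lambda>_. 0) \<Longrightarrow> rout s = [] \<Longrightarrow> tm s \<le> 20 + 30 * n \<Longrightarrow> Q s"
  shows "wp read_order Q (start_state (n # \<alpha> @ xs))"
proof -
  let ?s = "start_state (n # \<alpha> @ xs)"
  define I :: "nat \<Rightarrow> state \<Rightarrow> bool" where "I = (\<lambda>j s. sc s 3 = 0 \<and> rin s = drop j \<alpha> @ xs \<and>
     (\<forall>i<j. ar s 0 i = \<alpha> ! i) \<and> (\<forall>i<j. ar s 1 (\<alpha> ! i) = i) \<and> ar s 8 = (\<lambda>_. 0) \<and> ar s 9 = (\<lambda>_. 0) \<and>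
     rout s = [] \<and> tm s \<le> 10 + 30 * j)"
  have "wp (For 5 4 9 (Inp 10 ;; Put 0 5 10 ;; Put 1 10 5)) Q
      (?s\<lparr>rin := \<alpha> @ xs, sc := (sc ?s)(2 := 1, 4 := n, 5 := 0), tm := 3\<rparr>)"
  proof (rule wp_For[where I = I and a = 0 and b = n], goal_cases)
    case 10
    show ?case by (simp add: I_def start_state_def)
  next
    case (11 j s)
    have d: "drop j \<alpha> = \<alpha> ! j # drop (Suc j) \<alpha>"
      using 11 length_\<alpha> by (simp add: Cons_nth_drop_Suc)
    have ne: "\<alpha> ! i \<noteq> \<alpha> ! j" if "i < j" for i
      using \<alpha>_inj[of i j] 11 that by auto
    show ?case
      using 11 d ne unfolding I_def by (auto simp: less_Suc_eq)
  next
    case (12 s)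
    then have J: "I n s" by simp
    have "ar s 1 v = pos v" if "v < n" for v
      using J pos_less[OF that] \<alpha>_pos[OF that] unfolding I_def by metis
    then show ?case using 12 length_\<alpha> unfolding I_def by (intro Q) auto
  qed auto
  then show ?thesis by (simp add: read_order_def start_state_def numeral_3_eq_3)
qed

lemma wp_read_list:
  assumes s: "sc s 2 = 1" "sc s 3 = 0" "sc s 12 = x" "sc s 16 = q" "sc s 7 = q + length ys"
      "rin s = ys @ xs" "\<And>y. y \<in> set ys \<Longrightarrow> ar s 1 y = pos y"
    and Q: "\<And>s'. sc s' 2 = 1 \<Longrightarrow> sc s' 3 = 0 \<Longrightarrow> sc s' 4 = sc s 4 \<Longrightarrow> sc s' 5 = sc s 5 \<Longrightarrow>
      sc s' 10 = sc s 10 \<Longrightarrow> sc s' 12 = Max (insert x (pos ` set ys)) \<Longrightarrow> sc s' 16 = q + length ys \<Longrightarrow>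
      sc s' 17 = sc s 17 \<Longrightarrow> (\<And>k. k \<noteq> 4 \<Longrightarrow> ar s' k = ar s k) \<Longrightarrow>
      (\<And>k. k < q \<Longrightarrow> ar s' 4 k = ar s 4 k) \<Longrightarrow>
      (\<And>k. k < length ys \<Longrightarrow> ar s' 4 (q + k) = pos (ys ! k)) \<Longrightarrow> rin s' = xs \<Longrightarrow>
      rout s' = rout s \<Longrightarrow> tm s' \<le> tm s + 10 + 40 * length ys \<Longrightarrow> Q s'"
  shows "wp read_list Q s"
  unfolding read_list_def
proof -
  define m where "m k = Max (insert x (pos ` set (take k ys)))" for k
  have m_Suc: "m (Suc k) = max (pos (ys ! k)) (m k)" if "k < length ys" for k
    using that by (simp add: m_def take_Suc_conv_app_nth insert_commute[of x])
  have m_simps: "m 0 = x" "m (length ys) = Max (insert x (pos ` set ys))"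
    by (simp_all add: m_def)
  define I :: "nat \<Rightarrow> state \<Rightarrow> bool" where "I = (\<lambda>j s'. sc s' 3 = 0 \<and> sc s' 4 = sc s 4 \<and>
      sc s' 5 = sc s 5 \<and> sc s' 10 = sc s 10 \<and> sc s' 17 = sc s 17 \<and>
      sc s' 12 = m (j - q) \<and>
      (\<forall>k. k \<noteq> 4 \<longrightarrow> ar s' k = ar s k) \<and> (\<forall>k<q. ar s' 4 k = ar s 4 k) \<and>
      (\<forall>k<j - q. ar s' 4 (q + k) = pos (ys ! k)) \<and> rin s' = drop (j - q) ys @ xs \<and>
      rout s' = rout s \<and> tm s' \<le> tm s + 1 + 40 * (j - q))"
  show "wp (For 16 7 8 (Inp 15 ;; Get 11 1 15 ;; Put 4 16 11 ;; Minus 18 11 12 ;;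
        Cond 18 (Plus 12 11 3) (Lit 18 0))) Q s"
  proof (rule wp_For[where I = I and a = q and b = "q + length ys"], goal_cases)
    case 10
    show ?case using s by (simp add: I_def m_simps)
  next
    case (11 j s')
    define k where "k = j - q"
    have k: "j = q + k" "k < length ys" using 11 by (auto simp: k_def)
    have d: "drop k ys = ys ! k # drop (Suc k) ys" using k by (simp add: Cons_nth_drop_Suc)
    have p: "ar s' 1 (ys ! k) = pos (ys ! k)"
      using 11(1) s(7)[of "ys ! k"] k unfolding I_def by auto
    show ?case
      using 11 d p k unfolding I_def
      by (auto simp: m_Suc less_Suc_eq max_def)
  next
    case (12 s')
    then show ?case unfolding I_def by (intro Q) (auto simp: m_simps)
  qed (use s in auto)
qed

text \<open>Here \<open>q\<close> is the first free cell of array 4; the bound by \<open>q\<close>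
  protects finished segments from later writes.\<close>

definition read_vertex :: "(nat \<Rightarrow> nat \<Rightarrow> nat) \<Rightarrow> nat \<Rightarrow> nat \<Rightarrow> bool" where
  "read_vertex M q x \<longleftrightarrow> M 3 x = M 2 x + length (L x) \<and> M 3 x \<le> q \<and>
     (\<forall>k<length (L x). M 4 (M 2 x + k) = L x ! k) \<and> M 5 x = top x \<and>
     M 6 x = 2 * length (L x) \<and> M 7 x = 1"

lemma read_vertex_cong:
  assumes "read_vertex M q x" "\<And>k. k \<in> {2, 3, 5, 6, 7} \<Longrightarrow> M' k x = M k x"
    "\<And>l. l < q \<Longrightarrow> M' 4 l = M 4 l" "q \<le> q'"
  shows "read_vertex M' q' x"
  using assms unfolding read_vertex_def by auto

lemma wp_read_graph:
  assumes s: "sc s 2 = 1" "sc s 3 = 0" "sc s 4 = n" "\<And>v. v < n \<Longrightarrow> ar s 1 v = pos v"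
      "\<And>i. i < n \<Longrightarrow> ar s 0 i = \<alpha> ! i"
      "rin s = concat (map (\<lambda>xs. length xs # xs) A)"
    and Q: "\<And>s'. sc s' 2 = 1 \<Longrightarrow> sc s' 3 = 0 \<Longrightarrow> sc s' 4 = n \<Longrightarrow> loaded (ar s') \<Longrightarrow>
      keys 0 (ar s') \<Longrightarrow> ar s' 8 = ar s 8 \<Longrightarrow> ar s' 9 = ar s 9 \<Longrightarrow> rout s' = rout s \<Longrightarrow>
      tm s' \<le> tm s + 10 + 200 * (\<Sum>i<n. length (L i)) \<Longrightarrow> Q s'"
  shows "wp read_graph Q s"
proof -
  define I :: "nat \<Rightarrow> state \<Rightarrow> bool" where "I = (\<lambda>w s'. sc s' 3 = 0 \<and>
     rin s' = concat (map (\<lambda>xs. length xs # xs) (drop w A)) \<and>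
     (\<forall>k\<in>{0, 1, 8, 9}. ar s' k = ar s k) \<and> rout s' = rout s \<and>
     (\<forall>v<w. read_vertex (ar s') (sc s' 16) (pos v)) \<and>
     tm s' \<le> tm s + 5 + 200 * (\<Sum>v<w. length (L (pos v))))"
  have "wp (For 5 4 9
       (Inp 17 ;; Get 10 1 5 ;; Put 2 10 16 ;; Plus 12 10 3 ;; Plus 7 16 17 ;;
        read_list ;;
        Put 4 16 10 ;; Plus 16 16 2 ;; Put 3 10 16 ;; Put 5 10 12 ;;
        Plus 17 17 2 ;; Plus 17 17 17 ;; Put 6 10 17 ;; Put 7 10 2)) Q
      (s\<lparr>sc := (sc s)(16 := 0, 5 := 0), tm := tm s + 2\<rparr>)"
  proof (rule wp_For[where I = I and a = 0 and b = n], goal_cases)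
    case 10
    show ?case using s by (simp add: I_def)
  next
    case (11 w s')
    define x where "x = pos w"
    define q where "q = sc s' 16"
    let ?ys = "A ! w" let ?xs = "concat (map (\<lambda>xs. length xs # xs) (drop (Suc w) A))"
    have x: "x < n" "\<alpha> ! x = w" "ar s' 1 w = x"
      using 11 pos_less \<alpha>_pos s(4) by (auto simp: x_def I_def)
    have Lx: "L x = map pos ?ys @ [x]" using L_eq[OF x(1)] x(2) by simp
    have "rin s' = concat (map (\<lambda>xs. length xs # xs) (drop w A))" using 11(1) by (simp add: I_def)
    also have "drop w A = ?ys # drop (Suc w) A" using 11 length_A by (simp add: Cons_nth_drop_Suc)
    finally have rin: "rin s' = length ?ys # ?ys @ ?xs" by simp
    have top: "top x = Max (insert x (pos ` set ?ys))"
      using set_L[OF x(1)] Lx by (simp add: top_def flip: set_L[OF x(1)])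
    let ?s = "s'\<lparr>rin := ?ys @ ?xs, ar := (ar s')(2 := (ar s' 2)(x := q)),
      sc := (sc s')(17 := length ?ys, 10 := x, 12 := x, 7 := q + length ?ys), tm := tm s' + 20\<rparr>"
    have last: "I (Suc w) s4" if
      M: "ar s4 2 = (ar s' 2)(x := q)" "ar s4 3 = (ar s' 3)(x := q + length ?ys + 1)"
        "ar s4 5 = (ar s' 5)(x := top x)" "ar s4 6 = (ar s' 6)(x := 2 * (length ?ys + 1))"
        "ar s4 7 = (ar s' 7)(x := 1)" "\<And>l. l < q \<Longrightarrow> ar s4 4 l = ar s' 4 l"
        "\<And>k. k < length ?ys \<Longrightarrow> ar s4 4 (q + k) = pos (?ys ! k)" "ar s4 4 (q + length ?ys) = x"
        "\<And>k. k \<in> {0, 1, 8, 9} \<Longrightarrow> ar s4 k = ar s' k"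
      and r: "sc s4 3 = 0" "sc s4 16 = q + length ?ys + 1" "rin s4 = ?xs" "rout s4 = rout s'"
        "tm s4 \<le> tm s' + 100 + 40 * length ?ys" for s4
    proof -
      have "read_vertex (ar s4) (sc s4 16) (pos v)" if "v < Suc w" for v
      proof (cases "v = w")
        case True
        have "ar s4 4 (q + k) = L x ! k" if "k < length (L x)" for k
          using that M(7)[of k] M(8) by (cases "k = length ?ys") (auto simp: Lx nth_append)
        then show ?thesis
          using M(1-5) r(2) True by (simp add: read_vertex_def x_def[symmetric] Lx)
      next
        case False
        then have "v < w" using that by simp
        then have "pos v \<noteq> x" using pos_inj[of v w] 11 by (simp add: x_def)
        moreover have "read_vertex (ar s') q (pos v)" using 11(1) \<open>v < w\<close> by (simp add: I_def q_def)
        ultimately show ?thesis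
          by (elim read_vertex_cong) (use M(1-6) r(2) in auto)
      qed
      moreover have "tm s4 \<le> tm s + 5 + 200 * (\<Sum>v<Suc w. length (L (pos v)))"
        using 11(1) r(5) by (simp add: I_def x_def[symmetric] Lx)
      ultimately show ?thesis using M(9) r 11(1) unfolding I_def by simp
    qed
    let ?post = "\<lambda>s'. sc s' 5 = w \<and> sc s' 4 = n \<and> sc s' 2 = 1 \<and>
      I (Suc w) (s'\<lparr>sc := (sc s')(5 := Suc w, 9 := n - Suc w), tm := tm s' + 2\<rparr>)"
    have "wp read_list (wp (Put 4 16 10 ;; Plus 16 16 2 ;; Put 3 10 16 ;; Put 5 10 12 ;;
        Plus 17 17 2 ;; Plus 17 17 17 ;; Put 6 10 17 ;; Put 7 10 2) ?post) ?s"
    proof (rule wp_read_list[where x = x and q = q and ys = ?ys and xs = ?xs])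
      fix s1 :: state
      assume s1: "sc s1 2 = 1" "sc s1 3 = 0" "sc s1 4 = sc ?s 4" "sc s1 5 = sc ?s 5"
        "sc s1 10 = sc ?s 10" "sc s1 12 = Max (insert x (pos ` set ?ys))"
        "sc s1 16 = q + length ?ys" "sc s1 17 = sc ?s 17" "\<And>k. k \<noteq> 4 \<Longrightarrow> ar s1 k = ar ?s k"
        "\<And>k. k < q \<Longrightarrow> ar s1 4 k = ar ?s 4 k"
        "\<And>k. k < length ?ys \<Longrightarrow> ar s1 4 (q + k) = pos (?ys ! k)" "rin s1 = ?xs"
        "rout s1 = rout ?s" "tm s1 \<le> tm ?s + 10 + 40 * length ?ys"
      have e: "sc s1 4 = n" "sc s1 5 = w" "sc s1 10 = x" "sc s1 17 = length ?ys"
        using s1(3-5,8) 11 by simp_all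
      have ar: "ar s1 2 = (ar s' 2)(x := q)" "k \<noteq> 4 \<Longrightarrow> k \<noteq> 2 \<Longrightarrow> ar s1 k = ar s' k" for k
        using s1(9)[of k] s1(9)[of 2] by simp_all
      have s4: "ar s1 4 k = ar s' 4 k" if "k < q" for k using s1(10)[OF that] by simp
      show "wp (Put 4 16 10 ;; Plus 16 16 2 ;; Put 3 10 16 ;; Put 5 10 12 ;;
        Plus 17 17 2 ;; Plus 17 17 17 ;; Put 6 10 17 ;; Put 7 10 2) ?post s1"
        by (simp add: s1(1,2,6,7) e, rule last)
          (use s1(11,12,13,14) in \<open>auto simp: ar s4 s1(2) top\<close>)
    next
      fix y assume "y \<in> set ?ys"
      then have "y < n" using A_less[of w] 11 by auto
      then show "ar ?s 1 y = pos y" using 11(1) s(4) by (simp add: I_def)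
    qed (use 11 in \<open>auto simp: I_def q_def\<close>)
    moreover have "sc s' 3 = 0" "sc s' 16 = q" using 11(1) by (simp_all add: I_def q_def)
    ultimately show ?case
      using 11(2-4) rin x by (simp add: wp_Seq add_ac)
  next
    case (12 s')
    then have J: "I n s'" by simp
    have rv: "read_vertex (ar s') (sc s' 16) i" if "i < n" for i
      using J \<alpha>_less[OF that] pos_\<alpha>[OF that] unfolding I_def by metis
    have "loaded (ar s')"
      using rv J s(5) by (simp add: loaded_def read_vertex_def I_def)
    moreover have "keys 0 (ar s')"
      unfolding keys_def
    proof (intro allI impI)
      fix i assume i: "i < n"
      have "length (L i) = card {z. 0 \<le> z \<and> R i z}"
        using distinct_card[OF distinct_L[OF i]] set_L[OF i] by simp
      then show "ar s' 6 i = key 0 i \<and> ar s' 7 i = (if \<exists>z<0. R i z then 2 else 1)"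
        using rv[OF i] by (simp add: read_vertex_def key_def)
    qed
    \<comment> \<open>The input lists vertices by name, the arrays by position; the two sums differ
      by this renaming.\<close>
    moreover have "(\<Sum>v<n. length (L (pos v))) = (\<Sum>i<n. length (L i))"
      by (rule sum.reindex_bij_witness[of _ "\<lambda>i. \<alpha> ! i" pos])
        (auto simp: \<alpha>_pos pos_\<alpha> pos_less \<alpha>_less)
    ultimately show ?case using 12 s unfolding I_def by (intro Q) auto
  qed (use s in auto)
  then show ?thesis using s by (simp add: read_graph_def)
qed

end

context greedy_input
begin

lemma semitotal_program_correct:
  obtains s ds where "big semitotal_program (start_state (encode_input A \<alpha>)) s" "distinct ds"
    "rout s = map ((!) \<alpha>) ds" "semitotal (set ds)"
    "\<And>D. semitotal D \<Longrightarrow> card (set ds) \<le> card D"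
    "tm s \<le> 50 + 30 * n + 800 * (\<Sum>v<n. Suc (length (A ! v)))"
proof -
  let ?Q = "\<lambda>s. \<exists>ds. distinct ds \<and> rout s = map ((!) \<alpha>) ds \<and> semitotal (set ds) \<and>
    (\<forall>D. semitotal D \<longrightarrow> card (set ds) \<le> card D) \<and>
    tm s \<le> 50 + 30 * n + 800 * (\<Sum>i<n. length (L i))"
  have "wp read_order (wp read_graph (wp scan ?Q)) (start_state (n # \<alpha> @ concat (map (\<lambda>xs. length xs # xs) A)))"
  proof (rule wp_read_order)
    fix s :: state
    assume s: "sc s 2 = 1" "sc s 3 = 0" "sc s 4 = n" "rin s = concat (map (\<lambda>xs. length xs # xs) A)"
      "\<And>i. i < n \<Longrightarrow> ar s 0 i = \<alpha> ! i" "\<And>v. v < n \<Longrightarrow> ar s 1 v = pos v"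
      "ar s 8 = (\<lambda>_. 0)" "ar s 9 = (\<lambda>_. 0)" "rout s = []" "tm s \<le> 20 + 30 * n"
    show "wp read_graph (wp scan ?Q) s"
    proof (rule wp_read_graph[OF s(1-3,6,5,4)])
      fix s1 :: state
      assume s1: "sc s1 2 = 1" "sc s1 3 = 0" "sc s1 4 = n" "loaded (ar s1)" "keys 0 (ar s1)"
        "ar s1 8 = ar s 8" "ar s1 9 = ar s 9" "rout s1 = rout s"
        "tm s1 \<le> tm s + 10 + 200 * (\<Sum>i<n. length (L i))"
      show "wp scan ?Q s1"
      proof (rule wp_scan[OF s1(1-5)], goal_cases)
        case (4 s2 ds)
        then have "tm s2 \<le> 50 + 30 * n + 800 * (\<Sum>i<n. length (L i))"
          using s(10) s1(9) by linarith
        with 4 show ?case by blast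
      qed (use s s1 in simp_all)
    qed
  qed
  then obtain s ds where r: "big semitotal_program (start_state (encode_input A \<alpha>)) s" "distinct ds"
      "rout s = map ((!) \<alpha>) ds" "semitotal (set ds)" "\<forall>D. semitotal D \<longrightarrow> card (set ds) \<le> card D"
      "tm s \<le> 50 + 30 * n + 800 * (\<Sum>i<n. length (L i))"
    unfolding semitotal_program_def encode_input_def wp_Seq[symmetric] length_A
    unfolding wp_def by blast
  have "(\<Sum>i<n. length (L i)) = (\<Sum>i<n. Suc (length (A ! (\<alpha> ! i))))"
    by (intro sum.cong) (auto simp: L_eq)
  also have "\<dots> = (\<Sum>v<n. Suc (length (A ! v)))"
    by (rule sum.reindex_bij_witness[of _ pos "\<lambda>i. \<alpha> ! i"])
      (auto simp: \<alpha>_pos pos_\<alpha> pos_less \<alpha>_less)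
  finally show ?thesis using r by (intro that[of s ds]) auto
qed

end

section \<open>Strong elimination orderings\<close>

context pair_graph
begin

lemma nbrs_sym: "u \<in> nbrs G v \<longleftrightarrow> v \<in> nbrs G u"
  using arcs_ends_symmetric[OF pair_sym_arcs] by (auto simp: nbrs_def)

lemma nbrs_irrefl: "v \<notin> nbrs G v"
  using pair_no_loops by (fastforce simp: nbrs_def)

lemma nbrs_subset: "nbrs G v \<subseteq> pverts G"
  using in_arcsD2 by (auto simp: nbrs_def)

lemma nbrs_nonempty:
  assumes "connected G" "2 \<le> card (pverts G)" "v \<in> pverts G"
  shows "nbrs G v \<noteq> {}"
proof -
  have "\<not> pverts G \<subseteq> {v}"
    using assms(2) card_mono[of "{v}" "pverts G"] by auto
  then obtain u where u: "u \<in> pverts G" "u \<noteq> v" by blast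
  have "v \<rightarrow>\<^sup>*\<^bsub>mk_symmetric G\<^esub> u"
    using assms u by (auto simp: connected_def strongly_connected_def)
  then have "\<exists>w. v \<rightarrow>\<^bsub>mk_symmetric G\<^esub> w"
    using u(2) by (cases rule: pre_digraph.converse_reachable_cases) auto
  then show ?thesis
    using adj_mk_symmetric_eq[OF pair_sym_arcs] by (auto simp: nbrs_def)
qed

lemma graph_dist_le_2:
  assumes "u \<in> pverts G" "u \<noteq> v"
  shows "graph_dist G u v \<le> 2 \<longleftrightarrow> (\<exists>y. y \<in> closed_nbrs G u \<and> v \<in> closed_nbrs G y)"
proof
  assume le: "graph_dist G u v \<le> 2"
  have "\<exists>p. apath u p v \<and> length p \<le> 2"
  proof (rule ccontr)
    assume "\<nexists>p. apath u p v \<and> length p \<le> 2"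
    \<comment> \<open>Passing to the bound 3 makes the infimum argument uniform; it also covers the
      case of no path at all.\<close>
    then have "enat 3 \<le> enat (length p)" if "apath u p v" for p
      using that by (metis enat_ord_simps(1) eval_nat_numeral(3) not_less_eq_eq)
    then have "enat 3 \<le> graph_dist G u v"
      unfolding graph_dist_def by (intro INF_greatest) auto
    from this le have "enat 3 \<le> 2" by (rule order_trans)
    then show False by (simp add: numeral_eq_enat)
  qed
  then obtain p where p: "apath u p v" "length p \<le> 2" by blast
  consider "p = []" | e where "p = [e]" | e f where "p = [e, f]"
    using p(2) by (cases p; cases "tl p") (auto simp: neq_Nil_conv)
  then show "\<exists>y. y \<in> closed_nbrs G u \<and> v \<in> closed_nbrs G y"
  proof cases
    case 1
    then show ?thesis using p assms by (auto simp: apath_simps)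
  next
    case 2
    then have "(u, v) \<in> parcs G" using p by (cases e) (auto simp: apath_simps)
    then show ?thesis by (auto simp: closed_nbrs_def nbrs_def)
  next
    case 3
    then have "(u, snd e) \<in> parcs G" "(snd e, v) \<in> parcs G"
      using p by (cases e; cases f; auto simp: apath_simps)+
    then show ?thesis by (auto simp: closed_nbrs_def nbrs_def)
  qed
next
  assume "\<exists>y. y \<in> closed_nbrs G u \<and> v \<in> closed_nbrs G y"
  then obtain y where y: "y \<in> closed_nbrs G u" "v \<in> closed_nbrs G y" by blast
  have "\<exists>p. apath u p v \<and> length p \<le> 2"
  proof (cases "(u, v) \<in> parcs G")
    case True
    then have "apath u [(u, v)] v" using assms in_arcsD2 by (auto simp: apath_simps)
    then show ?thesis by fastforce
  next
    case False
    then have a: "(u, y) \<in> parcs G" "(y, v) \<in> parcs G"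
      using y assms by (auto simp: closed_nbrs_def nbrs_def)
    then have "u \<noteq> y" "y \<noteq> v" using pair_no_loops by fastforce+
    then have "apath u [(u, y), (y, v)] v"
      using a assms in_arcsD2 by (auto simp: apath_simps)
    then show ?thesis by fastforce
  qed
  then obtain p where "apath u p v" "length p \<le> 2" by blast
  then have "graph_dist G u v \<le> enat (length p)"
    unfolding graph_dist_def by (intro INF_lower) auto
  also have "\<dots> \<le> 2" using \<open>length p \<le> 2\<close> by (simp add: numeral_eq_enat)
  finally show "graph_dist G u v \<le> 2" .
qed

text \<open>Handshake bound: an unordered edge comes from at most two ordered pairs.\<close>

lemma sum_degrees_le: "(\<Sum>v\<in>pverts G. card (nbrs G v)) \<le> 2 * card (edges G)"
proof -
  define P :: "'a set \<Rightarrow> ('a \<times> 'a) set" where "P e = {p. {fst p, snd p} = e}" for e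
  have fin: "finite (edges G)"
    by (rule finite_subset[of _ "Pow (pverts G)"])
      (auto simp: edges_def pair_finite_verts dest: in_arcsD1 in_arcsD2)
  have two: "finite (P e)" "card (P e) \<le> 2" if e: "e \<in> edges G" for e
  proof -
    obtain a b where ab: "e = {a, b}" using e by (auto simp: edges_def)
    have sub: "P e \<subseteq> {(a, b), (b, a)}"
    proof
      fix p assume "p \<in> P e"
      then have "{fst p, snd p} = {a, b}" by (simp only: P_def ab mem_Collect_eq)
      then have "fst p = a \<and> snd p = b \<or> fst p = b \<and> snd p = a" by (simp only: doubleton_eq_iff)
      then have "p = (a, b) \<or> p = (b, a)" by (simp only: prod_eq_iff fst_conv snd_conv)
      then show "p \<in> {(a, b), (b, a)}" by simp
    qed
    then show "finite (P e)" by (rule finite_subset) simp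
    have "card (P e) \<le> card {(a, b), (b, a)}" by (rule card_mono[OF _ sub]) (intro finite.intros)
    also have "\<dots> \<le> 2" using card_length[of "[(a, b), (b, a)]"] by simp
    finally show "card (P e) \<le> 2" .
  qed
  have "(\<Sum>v\<in>pverts G. card (nbrs G v)) = card (SIGMA v:pverts G. nbrs G v)"
    using pair_finite_verts finite_subset[OF nbrs_subset] by (simp add: card_SigmaI)
  also have "\<dots> \<le> card (\<Union>e\<in>edges G. P e)"
  proof (rule card_mono)
    show "(SIGMA v:pverts G. nbrs G v) \<subseteq> (\<Union>e\<in>edges G. P e)"
    proof
      fix p assume "p \<in> (SIGMA v:pverts G. nbrs G v)"
      then have "fst p \<rightarrow>\<^bsub>G\<^esub> snd p" by (auto simp: nbrs_def)
      then have "{fst p, snd p} \<in> edges G" unfolding edges_def by blast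
      then show "p \<in> (\<Union>e\<in>edges G. P e)" by (auto simp: P_def)
    qed
  qed (use fin two in blast)
  also have "\<dots> \<le> (\<Sum>e\<in>edges G. card (P e))"
    by (rule card_UN_le[OF fin])
  also have "\<dots> \<le> (\<Sum>e\<in>edges G. 2)" by (rule sum_mono) (rule two)
  finally show ?thesis by simp
qed

end

section \<open>From the given graph and ordering to the matrix on positions\<close>

locale ordered_graph = pair_graph G for G :: "nat pair_pre_digraph" +
  fixes A :: "nat list list" and \<alpha> :: "nat list"
  assumes connected: "connected G" and card_verts: "3 \<le> card (pverts G)"
    and seo: "strong_elimination_ordering G \<alpha>" and adjacency: "adjacency_lists G A"
begin

abbreviation "n \<equiv> length A"

definition adj :: "nat \<Rightarrow> nat \<Rightarrow> bool" where
  "adj i j \<longleftrightarrow> i < n \<and> j < n \<and> \<alpha> ! j \<in> closed_nbrs G (\<alpha> ! i)"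

definition pos :: "nat \<Rightarrow> nat" where
  "pos v = (THE i. i < n \<and> \<alpha> ! i = v)"

definition nbr_list :: "nat \<Rightarrow> nat list" where
  "nbr_list i = map pos (A ! (\<alpha> ! i)) @ [i]"

lemma verts_eq: "pverts G = {..<n}"
  using adjacency by (simp add: adjacency_lists_def)

lemma A_props: "v < n \<Longrightarrow> distinct (A ! v)" "v < n \<Longrightarrow> set (A ! v) = nbrs G v"
  using adjacency by (auto simp: adjacency_lists_def)

lemma \<alpha>_props: "distinct \<alpha>" "set \<alpha> = {..<n}" "length \<alpha> = n"
proof -
  show *: "distinct \<alpha>" "set \<alpha> = {..<n}"
    using seo verts_eq by (auto simp: strong_elimination_ordering_def)
  show "length \<alpha> = n" using distinct_card[OF *(1)] *(2) by simp
qed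

lemma \<alpha>_nth_less: "i < n \<Longrightarrow> \<alpha> ! i < n"
  using \<alpha>_props nth_mem by fastforce

lemma nth_inj: "i < n \<Longrightarrow> j < n \<Longrightarrow> \<alpha> ! i = \<alpha> ! j \<longleftrightarrow> i = j"
  using nth_eq_iff_index_eq[OF \<alpha>_props(1)] \<alpha>_props(3) by simp

lemma pos_nth: "i < n \<Longrightarrow> pos (\<alpha> ! i) = i"
  unfolding pos_def by (rule the_equality) (auto simp: nth_inj)

lemma nth_pos:
  assumes "v < n"
  shows "pos v < n" "\<alpha> ! pos v = v"
proof -
  obtain i where "i < n" "\<alpha> ! i = v" using assms \<alpha>_props by (metis in_set_conv_nth lessThan_iff)
  then show "pos v < n" "\<alpha> ! pos v = v" using pos_nth by auto
qed

lemma mem_trunc_nbrs: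
  assumes "a < n" "l < n"
  shows "\<alpha> ! l \<in> trunc_nbrs G \<alpha> i a \<longleftrightarrow> i \<le> l \<and> adj a l"
  using assms by (auto simp: trunc_nbrs_def adj_def nth_inj \<alpha>_props(3))

lemma adj_sym: "adj i j \<Longrightarrow> adj j i"
  using nbrs_sym by (auto simp: adj_def closed_nbrs_def)

lemma adj_seo:
  assumes "i \<le> j" "j \<le> k" "adj i j" "adj i k" "i \<le> l" "adj j l"
  shows "adj k l"
proof -
  have lt: "i < n" "j < n" "k < n" "l < n" using assms by (auto simp: adj_def)
  have "trunc_nbrs G \<alpha> i j \<subseteq> trunc_nbrs G \<alpha> i k"
    using seo assms lt \<alpha>_props mem_trunc_nbrs unfolding strong_elimination_ordering_def by simp
  moreover have "\<alpha> ! l \<in> trunc_nbrs G \<alpha> i j" using assms lt mem_trunc_nbrs by simp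
  ultimately show ?thesis using lt mem_trunc_nbrs by blast
qed

text \<open>The ordering condition is applied at the smaller of \<open>i\<close> and
  \<open>k\<close>: at \<open>i\<close> it compares the neighbourhoods of \<open>k\<close> and
  \<open>l\<close>, at \<open>k\<close> those of \<open>i\<close> and \<open>j\<close>. Symmetry of
  \<open>adj\<close> makes both cases yield the same entry.\<close>

lemma adj_gamma_free:
  assumes "i \<le> j" "k \<le> l" "adj i k" "adj i l" "adj j k"
  shows "adj j l"
proof (cases "i \<le> k")
  case True
  then have "adj l j" using adj_seo[of i k l j] assms adj_sym by auto
  then show ?thesis by (rule adj_sym)
next
  case False
  then show ?thesis using adj_seo[of k i j l] assms adj_sym by auto
qed

lemma adj_iff: "i < n \<Longrightarrow> adj i j \<longleftrightarrow> j = i \<or> j < n \<and> \<alpha> ! j \<in> nbrs G (\<alpha> ! i)"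
  by (auto simp: adj_def closed_nbrs_def nth_inj)

lemma nbrs_less: "v < n \<Longrightarrow> nbrs G v \<subseteq> {..<n}"
  using nbrs_subset verts_eq by auto

lemma set_nbr_list:
  assumes "i < n"
  shows "set (nbr_list i) = {j. adj i j}"
proof -
  have "set (nbr_list i) = insert i (pos ` nbrs G (\<alpha> ! i))"
    using assms A_props(2)[OF \<alpha>_nth_less] by (simp add: nbr_list_def)
  also have "pos ` nbrs G (\<alpha> ! i) = {j. j < n \<and> \<alpha> ! j \<in> nbrs G (\<alpha> ! i)}" (is "_ = ?N")
  proof
    show "pos ` nbrs G (\<alpha> ! i) \<subseteq> ?N"
      using nbrs_less[OF \<alpha>_nth_less[OF assms]] nth_pos by auto
    show "?N \<subseteq> pos ` nbrs G (\<alpha> ! i)" using pos_nth by (metis (mono_tags, lifting) image_eqI mem_Collect_eq subsetI)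
  qed
  also have "insert i ?N = {j. adj i j}" using adj_iff[OF assms] by blast
  finally show ?thesis .
qed

lemma distinct_nbr_list:
  assumes "i < n"
  shows "distinct (nbr_list i)"
proof -
  have "inj_on pos {..<n}" using nth_pos(2) by (metis inj_onI lessThan_iff)
  moreover have "pos v \<noteq> i" if "v \<in> nbrs G (\<alpha> ! i)" for v
  proof
    assume "pos v = i"
    then have "\<alpha> ! i = v"
      using nth_pos(2)[of v] that nbrs_less[OF \<alpha>_nth_less[OF assms]] by auto
    with that nbrs_irrefl show False by blast
  qed
  ultimately show ?thesis
    using A_props[OF \<alpha>_nth_less[OF assms]] nbrs_less[OF \<alpha>_nth_less[OF assms]]
    by (auto simp: nbr_list_def distinct_map intro: inj_on_subset)
qed

text \<open>Connectedness with at least two vertices gives a proper neighbour, and \<open>i\<close>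
  itself is appended at the end. The first entry is the partner used when
  \<open>top i = u\<close>.\<close>

lemma hd_nbr_list:
  assumes "i < n"
  shows "nbr_list i ! 0 \<noteq> i"
proof -
  have "\<alpha> ! i \<in> pverts G" using \<alpha>_nth_less[OF assms] verts_eq by simp
  then have "nbrs G (\<alpha> ! i) \<noteq> {}" using nbrs_nonempty connected card_verts by simp
  then have "A ! (\<alpha> ! i) \<noteq> []" using A_props(2)[OF \<alpha>_nth_less[OF assms]] by auto
  then have "0 < length (map pos (A ! (\<alpha> ! i)))" by simp
  then have "nbr_list i ! 0 \<in> set (map pos (A ! (\<alpha> ! i)))"
    unfolding nbr_list_def nth_append by (simp only: if_True nth_mem)
  then show ?thesis using distinct_nbr_list[OF assms] by (auto simp: nbr_list_def)
qed

sublocale greedy_input n adj nbr_list \<alpha> A pos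
proof unfold_locales
  show "adj i j \<Longrightarrow> i < n" for i j by (simp add: adj_def)
  show "i < n \<Longrightarrow> adj i i" for i by (simp add: adj_def closed_nbrs_def)
  show "i \<le> j \<Longrightarrow> k \<le> l \<Longrightarrow> adj i k \<Longrightarrow> adj i l \<Longrightarrow> adj j k \<Longrightarrow> adj j l" for i j k l
    by (rule adj_gamma_free)
  show "v < n \<Longrightarrow> set (A ! v) \<subseteq> {..<n}" for v using A_props nbrs_less by simp
qed (use adj_sym set_nbr_list distinct_nbr_list hd_nbr_list \<alpha>_props \<alpha>_nth_less pos_nth nth_pos
    in \<open>simp_all add: nbr_list_def\<close>)

lemma semitotal_iff:
  assumes "D \<subseteq> {..<n}"
  shows "semitotal_dominating_set G ((!) \<alpha> ` D) \<longleftrightarrow> semitotal D"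
proof -
  have inj: "\<alpha> ! i = \<alpha> ! j \<longleftrightarrow> i = j" if "i < n" "j < n" for i j
    using that by (rule nth_inj)
  have sub: "(!) \<alpha> ` D \<subseteq> pverts G" using assms \<alpha>_nth_less verts_eq by auto
  have "dominating_set G ((!) \<alpha> ` D) \<longleftrightarrow> (\<forall>v<n. dominated D v)"
  proof
    assume dom: "dominating_set G ((!) \<alpha> ` D)"
    show "\<forall>v<n. dominated D v"
    proof (intro allI impI)
      fix v assume v: "v < n"
      show "dominated D v"
      proof (cases "v \<in> D")
        case True
        then show ?thesis using v R_refl by (auto simp: dominated_def)
      next
        case False
        then have "\<alpha> ! v \<in> pverts G - (!) \<alpha> ` D"
          using v assms inj \<alpha>_nth_less verts_eq by auto
        then have "\<exists>u\<in>(!) \<alpha> ` D. (\<alpha> ! v, u) \<in> parcs G"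
          using dom unfolding dominating_set_def with_proj_simps by blast
        then obtain d where "d \<in> D" "(\<alpha> ! v, \<alpha> ! d) \<in> parcs G" by blast
        then show ?thesis
          using assms v by (auto simp: dominated_def adj_def closed_nbrs_def nbrs_def)
      qed
    qed
  next
    assume dom: "\<forall>v<n. dominated D v"
    have "\<exists>u\<in>(!) \<alpha> ` D. (v, u) \<in> parcs G" if v: "v \<in> pverts G - (!) \<alpha> ` D" for v
    proof -
      have "v < n" using v verts_eq by auto
      then obtain d where d: "d \<in> D" "adj (pos v) d"
        using dom nth_pos(1) unfolding dominated_def by blast
      then have "\<alpha> ! d \<noteq> v" using v by auto
      then show ?thesis
        using d nth_pos[OF \<open>v < n\<close>] by (auto simp: adj_def closed_nbrs_def nbrs_def)
    qed
    then show "dominating_set G ((!) \<alpha> ` D)" using sub by (simp add: dominating_set_def)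
  qed
  moreover have "(\<exists>v\<in>(!) \<alpha> ` D. v \<noteq> \<alpha> ! u \<and> graph_dist G (\<alpha> ! u) v \<le> 2) \<longleftrightarrow> near D u"
    if u: "u \<in> D" for u
  proof -
    have "(\<exists>y. y \<in> closed_nbrs G (\<alpha> ! u) \<and> \<alpha> ! d \<in> closed_nbrs G y) \<longleftrightarrow>
        (\<exists>y. adj u y \<and> adj y d)" if d: "d \<in> D" for d
    proof
      assume "\<exists>y. y \<in> closed_nbrs G (\<alpha> ! u) \<and> \<alpha> ! d \<in> closed_nbrs G y"
      then obtain y where y: "y \<in> closed_nbrs G (\<alpha> ! u)" "\<alpha> ! d \<in> closed_nbrs G y" by blast
      have un: "u < n" "d < n" using u d assms by auto
      then have yn: "y < n" using y(1) nbrs_less[OF \<alpha>_nth_less] \<alpha>_nth_less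
        by (auto simp: closed_nbrs_def)
      then have "adj u (pos y) \<and> adj (pos y) d" using y un nth_pos[OF yn] by (simp add: adj_def)
      then show "\<exists>y. adj u y \<and> adj y d" by blast
    qed (auto simp: adj_def)
    moreover have "graph_dist G (\<alpha> ! u) (\<alpha> ! d) \<le> 2 \<longleftrightarrow>
        (\<exists>y. y \<in> closed_nbrs G (\<alpha> ! u) \<and> \<alpha> ! d \<in> closed_nbrs G y)" if "d \<in> D" "d \<noteq> u" for d
    proof (rule graph_dist_le_2)
      show "\<alpha> ! u \<in> pverts G" using sub u by auto
      show "\<alpha> ! u \<noteq> \<alpha> ! d" using inj[of u d] that u assms by auto
    qed
    moreover have "\<alpha> ! d \<noteq> \<alpha> ! u \<longleftrightarrow> d \<noteq> u" if "d \<in> D" for d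
      using inj[of d u] that u assms by auto
    ultimately show ?thesis unfolding near_def by auto
  qed
  ultimately show ?thesis
    using assms by (simp add: semitotal_dominating_set_def semitotal_def)
qed

lemma min_semitotal_image:
  assumes D: "semitotal D" "\<And>D'. semitotal D' \<Longrightarrow> card D \<le> card D'"
  shows "min_semitotal_dominating_set G ((!) \<alpha> ` D)"
  unfolding min_semitotal_dominating_set_def
proof (intro conjI allI impI)
  have sub: "D \<subseteq> {..<n}" using D(1) by (simp add: semitotal_def)
  show "semitotal_dominating_set G ((!) \<alpha> ` D)" using semitotal_iff[OF sub] D(1) by simp
  fix D' assume D': "semitotal_dominating_set G D'"
  then have D'n: "D' \<subseteq> {..<n}"
    using verts_eq by (simp add: semitotal_dominating_set_def dominating_set_def)
  then have "\<alpha> ! pos v = v" "pos v < n" if "v \<in> D'" for v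
    using nth_pos[of v] that by auto
  then have eq: "(!) \<alpha> ` pos ` D' = D'" "pos ` D' \<subseteq> {..<n}"
    by (simp_all add: image_image subset_eq)
  have "card ((!) \<alpha> ` D) \<le> card D"
    by (rule card_image_le) (use sub finite_subset in auto)
  also have "\<dots> \<le> card (pos ` D')" using D(2) semitotal_iff[OF eq(2)] eq(1) D' by simp
  also have "\<dots> \<le> card D'" by (rule card_image_le) (use D'n finite_subset in auto)
  finally show "card ((!) \<alpha> ` D) \<le> card D'" .
qed

lemma computes_min_semitotal:
  "\<exists>ys. computes_within (compile 0 semitotal_program) (encode_input A \<alpha>)
      (2000 * (card (pverts G) + card (edges G))) ys \<and>
    distinct ys \<and> min_semitotal_dominating_set G (set ys)"
proof -
  obtain s ds where r: "big semitotal_program (start_state (encode_input A \<alpha>)) s" "distinct ds"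
    "rout s = map ((!) \<alpha>) ds" "semitotal (set ds)"
    "\<And>D. semitotal D \<Longrightarrow> card (set ds) \<le> card D"
    "tm s \<le> 50 + 30 * n + 800 * (\<Sum>v<n. Suc (length (A ! v)))"
    using semitotal_program_correct by blast
  have "(\<Sum>v<n. length (A ! v)) = (\<Sum>v\<in>pverts G. card (nbrs G v))"
    unfolding verts_eq
    by (intro sum.cong) (use A_props in \<open>auto simp flip: distinct_card\<close>)
  also have "\<dots> \<le> 2 * card (edges G)" by (rule sum_degrees_le)
  finally have "(\<Sum>v<n. Suc (length (A ! v))) \<le> n + 2 * card (edges G)"
    by (simp add: sum.distrib sum_Suc)
  \<comment> \<open>The clock bound becomes \<open>50 + 830 * n + 1600 * card (edges G)\<close>; a
    positive \<open>n\<close> lets the constant 50 be absorbed into the factor 2000.\<close>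
  moreover have "3 \<le> n" using card_verts verts_eq by simp
  ultimately have "tm s \<le> 2000 * (card (pverts G) + card (edges G))"
    using r(6) verts_eq by simp
  note computes_within_compile[OF r(1) wf_semitotal_program this]
  moreover have "set ds \<subseteq> {..<n}" using r(4) by (simp add: semitotal_def)
  then have "distinct (rout s)"
    using r(2,3) nth_inj by (auto simp: distinct_map inj_on_def subset_eq)
  moreover have "min_semitotal_dominating_set G (set (rout s))"
    using min_semitotal_image[OF r(4,5)] r(3) by simp
  ultimately show ?thesis by blast
qed

end

theorem theorem4p1:
  shows "\<exists>(P :: instr list) (c :: nat).
    \<forall>(G :: nat pair_pre_digraph) (A :: nat list list) (\<alpha> :: nat list).
      pair_graph G \<and> connected (with_proj G) \<and> card (verts (with_proj G)) \<ge> 3 \<and>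
      strongly_chordal (with_proj G) \<and>
      strong_elimination_ordering (with_proj G) \<alpha> \<and>
      adjacency_lists (with_proj G) A \<longrightarrow>
      (\<exists>ys. computes_within P (encode_input A \<alpha>)
               (c * (card (verts (with_proj G)) + card (edges (with_proj G)))) ys \<and>
            distinct ys \<and> min_semitotal_dominating_set (with_proj G) (set ys))"
proof (intro exI[of _ "compile 0 semitotal_program"] exI[of _ 2000] allI impI)
  fix G :: "nat pair_pre_digraph" and A :: "nat list list" and \<alpha> :: "nat list"
  assume *: "pair_graph G \<and> connected (with_proj G) \<and> card (verts (with_proj G)) \<ge> 3 \<and>
      strongly_chordal (with_proj G) \<and> strong_elimination_ordering (with_proj G) \<alpha> \<and>
      adjacency_lists (with_proj G) A"
  then interpret ordered_graph G A \<alpha>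
    by (simp add: ordered_graph_def ordered_graph_axioms_def)
  show "\<exists>ys. computes_within (compile 0 semitotal_program) (encode_input A \<alpha>)
      (2000 * (card (verts (with_proj G)) + card (edges (with_proj G)))) ys \<and>
      distinct ys \<and> min_semitotal_dominating_set (with_proj G) (set ys)"
    using computes_min_semitotal by simp
qed

end
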